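(* Let $(M,L)$ be a Finsler manifold, let $L\to\overline{L}=e^{\sigma}L+\beta$, $\beta=b_i(x)y^i$, be a $\beta$-conformal change, and let $D^i_{jk}=\overline{\Gamma}^i_{jk}-\Gamma^i_{jk}$ be the difference of the Cartan connection coefficients of $(M,\overline{L})$ and $(M,L)$. (i) If the change is conformal ($\beta=0$), then $D^i_{jk}$ vanishes identically if and only if $\sigma$ is homothetic (i.e. $\partial_i\sigma=0$ for all $i$). (ii) If the change is a $\beta$-change ($\sigma=0$), then $D^i_{jk}$ vanishes identically if and only if $b_i$ is Cartan-parallel, i.e. $b_{i|j}=0$.
   Context: $M$ is an $n$-dimensional $C^\infty$ manifold, $L(x,y)$ a Finsler metric function; all objects are considered in local coordinates $(x^i,y^i)$ at $y\neq0$. A $\beta$-conformal change is $L\to\overline{L}=e^{\sigma}L+\beta$, with $\sigma$ a smooth function on $M$ and $\beta=b_i(x)y^i$ a 1-form on $M$; $\overline{L}$ is assumed to be a Finsler metric function too. $\partial_i=\partial/\partial x^i$, $\dot\partial_i=\partial/\partial y^i$; summation convention. Cartan connection of $(M,L)$: $g_{ij}=\frac12\dot\partial_i\dot\partial_jL^2$ with inverse $g^{ij}$; $N^i_j=\frac12\dot\partial_jS^i$ with $S^i=\frac12g^{ir}(y^k\partial_k\dot\partial_rL^2-\partial_rL^2)$, $\delta_k=\partial_k-N^r_k\dot\partial_r$, $\Gamma^i_{jk}=\frac12g^{ir}(\delta_jg_{rk}+\delta_kg_{rj}-\delta_rg_{jk})$. $\overline{\Gamma}^i_{jk}$ is the same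 object built from $\overline{L}$. The $h$-covariant derivative of $b_i$ is $b_{i|j}=\delta_jb_i-b_r\Gamma^r_{ij}$. *)

theory Defs
  imports "HOL-Analysis.Analysis"
begin

section \<open>Smooth functions and smooth manifolds\<close>

fun Ck_on :: "nat \<Rightarrow> 'a::real_normed_vector set \<Rightarrow> ('a \<Rightarrow> 'b::real_normed_vector) \<Rightarrow> bool" where
  "Ck_on 0 S f \<longleftrightarrow> continuous_on S f"
| "Ck_on (Suc k) S f \<longleftrightarrow>
     (\<forall>x\<in>S. f differentiable (at x)) \<and> (\<forall>v. Ck_on k S (\<lambda>x. frechet_derivative f (at x) v))"

text \<open>Only meant for open sets (the derivatives are those at a point, not within the set) of
  finite-dimensional spaces.\<close>

definition smooth_on :: "'a::real_normed_vector set \<Rightarrow> ('a \<Rightarrow> 'b::real_normed_vector) \<Rightarrow> bool" where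
  "smooth_on S f \<longleftrightarrow> (\<forall>k. Ck_on k S f)"

type_synonym ('m, 'n) chart = "'m set \<times> ('m \<Rightarrow> real ^ 'n)"

definition coord_dom :: "('m, 'n::finite) chart \<Rightarrow> (real ^ 'n) set" where
  "coord_dom c = snd c ` fst c"

definition chart_inv :: "('m, 'n::finite) chart \<Rightarrow> real ^ 'n \<Rightarrow> 'm" where
  "chart_inv c = inv_into (fst c) (snd c)"

definition overlap :: "('m, 'n::finite) chart \<Rightarrow> ('m, 'n) chart \<Rightarrow> (real ^ 'n) set" where
  "overlap c d = snd c ` (fst c \<inter> fst d)"

definition transition :: "('m, 'n::finite) chart \<Rightarrow> ('m, 'n) chart \<Rightarrow> real ^ 'n \<Rightarrow> real ^ 'n" where
  "transition c d = snd d \<circ> chart_inv c"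

definition smooth_manifold :: "'m topology \<Rightarrow> ('m, 'n::finite) chart set \<Rightarrow> bool" where
  "smooth_manifold M \<A> \<longleftrightarrow>
     Hausdorff_space M \<and> second_countable M \<and>
     (\<Union>c\<in>\<A>. fst c) = topspace M \<and>
     (\<forall>c\<in>\<A>. openin M (fst c) \<and> open (coord_dom c) \<and>
        homeomorphic_map (subtopology M (fst c)) (top_of_set (coord_dom c)) (snd c)) \<and>
     (\<forall>c\<in>\<A>. \<forall>d\<in>\<A>. smooth_on (overlap c d) (transition c d))"

definition local_rep :: "('m \<Rightarrow> real) \<Rightarrow> ('m, 'n::finite) chart \<Rightarrow> real ^ 'n \<Rightarrow> real" where
  "local_rep \<sigma> c = \<sigma> \<circ> chart_inv c"

definition smooth_function :: "('m, 'n::finite) chart set \<Rightarrow> ('m \<Rightarrow> real) \<Rightarrow> bool" where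
  "smooth_function \<A> \<sigma> \<longleftrightarrow> (\<forall>c\<in>\<A>. smooth_on (coord_dom c) (local_rep \<sigma> c))"

text \<open>A 1-form is given by its components \<open>b c x $ i\<close> in every chart \<open>c\<close> at the point with
  coordinates \<open>x\<close>; the second condition is the covector transformation law
  \<open>b\<^sub>i = b'\<^sub>j \<partial>x'\<^sup>j / \<partial>x\<^sup>i\<close>, contracted with an arbitrary \<open>y\<close>.\<close>

definition one_form ::
    "('m, 'n::finite) chart set \<Rightarrow> (('m, 'n) chart \<Rightarrow> real ^ 'n \<Rightarrow> real ^ 'n) \<Rightarrow> bool" where
  "one_form \<A> b \<longleftrightarrow>
     (\<forall>c\<in>\<A>. smooth_on (coord_dom c) (b c)) \<and>
     (\<forall>c\<in>\<A>. \<forall>d\<in>\<A>. \<forall>x\<in>overlap c d. \<forall>y.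
        b c x \<bullet> y = b d (transition c d x) \<bullet> frechet_derivative (transition c d) (at x) y)"

section \<open>Finsler metric functions and the Cartan connection in local coordinates\<close>

text \<open>A function on (an open subset of) the tangent bundle is written \<open>F x y\<close> in local coordinates;
  \<open>dx k\<close> and \<open>dy k\<close> are the partial derivatives by \<open>x\<^sup>k\<close> and \<open>y\<^sup>k\<close>.\<close>

definition dx :: "'n \<Rightarrow> (real ^ 'n \<Rightarrow> real ^ 'n \<Rightarrow> real) \<Rightarrow> real ^ 'n::finite \<Rightarrow> real ^ 'n \<Rightarrow> real" where
  "dx k F x y = deriv (\<lambda>t. F (x + t *\<^sub>R axis k 1) y) 0"

definition dy :: "'n \<Rightarrow> (real ^ 'n \<Rightarrow> real ^ 'n \<Rightarrow> real) \<Rightarrow> real ^ 'n::finite \<Rightarrow> real ^ 'n \<Rightarrow> real" where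
  "dy k F x y = deriv (\<lambda>t. F x (y + t *\<^sub>R axis k 1)) 0"

abbreviation sq :: "(real ^ 'n \<Rightarrow> real ^ 'n \<Rightarrow> real) \<Rightarrow> real ^ 'n::finite \<Rightarrow> real ^ 'n \<Rightarrow> real" where
  "sq F \<equiv> \<lambda>x y. (F x y)\<^sup>2"

definition metric :: "(real ^ 'n \<Rightarrow> real ^ 'n \<Rightarrow> real) \<Rightarrow> 'n \<Rightarrow> 'n
    \<Rightarrow> real ^ 'n::finite \<Rightarrow> real ^ 'n \<Rightarrow> real" where
  "metric F i j x y = dy i (dy j (sq F)) x y / 2"

definition metric_inv :: "(real ^ 'n \<Rightarrow> real ^ 'n \<Rightarrow> real) \<Rightarrow> 'n \<Rightarrow> 'n
    \<Rightarrow> real ^ 'n::finite \<Rightarrow> real ^ 'n \<Rightarrow> real" where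
  "metric_inv F i j x y = matrix_inv (\<chi> k l. metric F k l x y) $ i $ j"

definition spray :: "(real ^ 'n \<Rightarrow> real ^ 'n \<Rightarrow> real) \<Rightarrow> 'n
    \<Rightarrow> real ^ 'n::finite \<Rightarrow> real ^ 'n \<Rightarrow> real" where
  "spray F i x y = 1/2 * (\<Sum>r\<in>UNIV. metric_inv F i r x y *
      ((\<Sum>k\<in>UNIV. y $ k * dx k (dy r (sq F)) x y) - dx r (sq F) x y))"

text \<open>\<open>nonlin F i j\<close> is \<open>N\<^sup>i\<^sub>j\<close>: the first index is the upper one.\<close>

definition nonlin :: "(real ^ 'n \<Rightarrow> real ^ 'n \<Rightarrow> real) \<Rightarrow> 'n \<Rightarrow> 'n
    \<Rightarrow> real ^ 'n::finite \<Rightarrow> real ^ 'n \<Rightarrow> real" where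
  "nonlin F i j x y = dy j (spray F i) x y / 2"

definition hdelta :: "(real ^ 'n \<Rightarrow> real ^ 'n \<Rightarrow> real) \<Rightarrow> 'n \<Rightarrow> (real ^ 'n \<Rightarrow> real ^ 'n \<Rightarrow> real)
    \<Rightarrow> real ^ 'n::finite \<Rightarrow> real ^ 'n \<Rightarrow> real" where
  "hdelta F k H x y = dx k H x y - (\<Sum>r\<in>UNIV. nonlin F r k x y * dy r H x y)"

text \<open>\<open>cartan F i j k\<close> is \<open>\<Gamma>\<^sup>i\<^sub>j\<^sub>k\<close>: the first index is the upper one.\<close>

definition cartan :: "(real ^ 'n \<Rightarrow> real ^ 'n \<Rightarrow> real) \<Rightarrow> 'n \<Rightarrow> 'n \<Rightarrow> 'n
    \<Rightarrow> real ^ 'n::finite \<Rightarrow> real ^ 'n \<Rightarrow> real" where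
  "cartan F i j k x y = 1/2 * (\<Sum>r\<in>UNIV. metric_inv F i r x y *
      (hdelta F j (metric F r k) x y + hdelta F k (metric F r j) x y
       - hdelta F r (metric F j k) x y))"

definition hcov :: "(real ^ 'n \<Rightarrow> real ^ 'n \<Rightarrow> real) \<Rightarrow> (real ^ 'n \<Rightarrow> real ^ 'n) \<Rightarrow> 'n \<Rightarrow> 'n
    \<Rightarrow> real ^ 'n::finite \<Rightarrow> real ^ 'n \<Rightarrow> real" where
  "hcov F b i j x y = hdelta F j (\<lambda>x y. b x $ i) x y - (\<Sum>r\<in>UNIV. b x $ r * cartan F r i j x y)"

text \<open>A function on the tangent bundle is given by its local expressions \<open>L c\<close> in all charts \<open>c\<close>,
  related by the tangent maps of the transitions (last condition).\<close>

definition finsler_metric ::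
    "('m, 'n::finite) chart set \<Rightarrow> (('m, 'n) chart \<Rightarrow> real ^ 'n \<Rightarrow> real ^ 'n \<Rightarrow> real) \<Rightarrow> bool" where
  "finsler_metric \<A> L \<longleftrightarrow>
     (\<forall>c\<in>\<A>. smooth_on (coord_dom c \<times> (- {0})) (\<lambda>(x, y). L c x y)) \<and>
     (\<forall>c\<in>\<A>. \<forall>x\<in>coord_dom c. \<forall>y. \<forall>t>0. L c x (t *\<^sub>R y) = t * L c x y) \<and>
     (\<forall>c\<in>\<A>. \<forall>x\<in>coord_dom c. \<forall>y. y \<noteq> 0 \<longrightarrow> L c x y > 0) \<and>
     (\<forall>c\<in>\<A>. \<forall>x\<in>coord_dom c. \<forall>y. y \<noteq> 0 \<longrightarrow>
        (\<forall>v. v \<noteq> 0 \<longrightarrow> (\<Sum>i\<in>UNIV. \<Sum>j\<in>UNIV. metric (L c) i j x y * v $ i * v $ j) > 0)) \<and>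
     (\<forall>c\<in>\<A>. \<forall>d\<in>\<A>. \<forall>x\<in>overlap c d. \<forall>y.
        L c x y = L d (transition c d x) (frechet_derivative (transition c d) (at x) y))"

section \<open>Beta-conformal changes\<close>

definition beta_conformal_change ::
    "('m \<Rightarrow> real) \<Rightarrow> (('m, 'n) chart \<Rightarrow> real ^ 'n \<Rightarrow> real ^ 'n)
      \<Rightarrow> (('m, 'n::finite) chart \<Rightarrow> real ^ 'n \<Rightarrow> real ^ 'n \<Rightarrow> real)
      \<Rightarrow> ('m, 'n) chart \<Rightarrow> real ^ 'n \<Rightarrow> real ^ 'n \<Rightarrow> real" where
  "beta_conformal_change \<sigma> b L c x y = exp (local_rep \<sigma> c x) * L c x y + (\<Sum>i\<in>UNIV. b c x $ i * y $ i)"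

definition cartan_diff :: "(real ^ 'n \<Rightarrow> real ^ 'n \<Rightarrow> real) \<Rightarrow> (real ^ 'n \<Rightarrow> real ^ 'n \<Rightarrow> real)
    \<Rightarrow> 'n \<Rightarrow> 'n \<Rightarrow> 'n \<Rightarrow> real ^ 'n::finite \<Rightarrow> real ^ 'n \<Rightarrow> real" where
  "cartan_diff F' F i j k x y = cartan F' i j k x y - cartan F i j k x y"

definition cartan_diff_vanishes ::
    "('m, 'n::finite) chart set \<Rightarrow> (('m, 'n) chart \<Rightarrow> real ^ 'n \<Rightarrow> real ^ 'n \<Rightarrow> real)
      \<Rightarrow> (('m, 'n) chart \<Rightarrow> real ^ 'n \<Rightarrow> real ^ 'n \<Rightarrow> real) \<Rightarrow> bool" where
  "cartan_diff_vanishes \<A> L' L \<longleftrightarrow>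
     (\<forall>c\<in>\<A>. \<forall>x\<in>coord_dom c. \<forall>y. y \<noteq> 0 \<longrightarrow> (\<forall>i j k. cartan_diff (L' c) (L c) i j k x y = 0))"

definition homothetic :: "('m, 'n::finite) chart set \<Rightarrow> ('m \<Rightarrow> real) \<Rightarrow> bool" where
  "homothetic \<A> \<sigma> \<longleftrightarrow>
     (\<forall>c\<in>\<A>. \<forall>x\<in>coord_dom c. \<forall>i. deriv (\<lambda>t. local_rep \<sigma> c (x + t *\<^sub>R axis i 1)) 0 = 0)"

definition cartan_parallel ::
    "('m, 'n::finite) chart set \<Rightarrow> (('m, 'n) chart \<Rightarrow> real ^ 'n \<Rightarrow> real ^ 'n \<Rightarrow> real)
      \<Rightarrow> (('m, 'n) chart \<Rightarrow> real ^ 'n \<Rightarrow> real ^ 'n) \<Rightarrow> bool" where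
  "cartan_parallel \<A> L b \<longleftrightarrow>
     (\<forall>c\<in>\<A>. \<forall>x\<in>coord_dom c. \<forall>y. y \<noteq> 0 \<longrightarrow> (\<forall>i j. hcov (L c) (b c) i j x y = 0))"

end

theory Submission
  imports Defs
begin

text \<open>For a Finsler function \<open>F\<close> the horizontal derivatives \<open>\<delta>\<^sub>k\<close> annihilate \<open>F\<close>, the Cartan
  coefficients are metrical and satisfy \<open>y\<^sup>j \<Gamma>\<^sup>i\<^sub>j\<^sub>k = N\<^sup>i\<^sub>k\<close>; hence \<open>\<partial>F/\<partial>y\<^sup>i\<close> is parallel. Write
  \<open>G = e F + b\<^sub>i y\<^sup>i\<close>, so that \<open>\<partial>G/\<partial>y\<^sup>i = e \<partial>F/\<partial>y\<^sup>i + b\<^sub>i\<close>. If both connections agree, then so do the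
  nonlinear ones, and comparing the covariant derivatives of both sides gives
  \<open>(\<partial>\<^sub>k e) \<partial>F/\<partial>y\<^sup>i + b\<^bsub>i|k\<^esub> = 0\<close>, which yields the forward half of both claims. Conversely, if \<open>e\<close> is
  constant and \<open>b\<close> is parallel, then the horizontal lift of \<open>F\<close> annihilates \<open>G\<close>, which forces the
  sprays to agree, and the metric of \<open>G\<close>, a combination of parallel tensors, is parallel for the
  connection of \<open>F\<close>, which forces the connections to agree.\<close>

subsection \<open>Smooth functions\<close>

text \<open>A derivative at a point of an open set sees only values inside the set, so the
  derivatives of \<open>f\<close> and \<open>g\<close> agree on \<open>S\<close> and the induction
  hypothesis applies to them.\<close>

lemma Ck_on_cong:
  assumes "open S" "\<And>x. x \<in> S \<Longrightarrow> f x = g x" "Ck_on k S f"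
  shows "Ck_on k S g"
  using assms(2,3)
proof (induction k arbitrary: f g)
  case 0
  then show ?case by (simp cong: continuous_on_cong)
next
  case (Suc k)
  have d: "(g has_derivative frechet_derivative f (at x)) (at x)" if "x \<in> S" for x
    using Suc.prems that \<open>open S\<close>
    by (intro has_derivative_transform_within_open[of f _ x UNIV S g])
       (auto simp: frechet_derivative_works)
  have e: "frechet_derivative f (at x) = frechet_derivative g (at x)" if "x \<in> S" for x
    using d[OF that] frechet_derivative_at by blast
  show ?case
    using Suc.prems(2) d
    by (auto simp: differentiable_def e
        intro: Suc.IH[of "\<lambda>x. frechet_derivative f (at x) v" "\<lambda>x. frechet_derivative g (at x) v" for v])
qed

lemma Ck_on_SucD: "Ck_on (Suc k) S f \<Longrightarrow> Ck_on k S f"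
proof (induction k arbitrary: f)
  case 0
  then show ?case
    by (auto intro!: continuous_at_imp_continuous_on differentiable_imp_continuous_within)
next
  case (Suc k)
  then show ?case by (metis Ck_on.simps(2))
qed

text \<open>By uniqueness of the derivative, an explicit formula may stand in for
  \<open>frechet_derivative\<close> on an open set. The closure rules below all go through this
  form.\<close>

lemma Ck_on_SucI:
  assumes "open S" "\<And>x. x \<in> S \<Longrightarrow> (f has_derivative f' x) (at x)"
    "\<And>v. Ck_on k S (\<lambda>x. f' x v)"
  shows "Ck_on (Suc k) S f"
proof -
  have "frechet_derivative f (at x) = f' x" if "x \<in> S" for x
    using assms(2)[OF that] frechet_derivative_at by metis
  then show ?thesis
    using assms by (auto simp: differentiable_def intro: Ck_on_cong[OF assms(1) _ assms(3)])
qed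

lemma Ck_on_SucE:
  assumes "Ck_on (Suc k) S f"
  shows "x \<in> S \<Longrightarrow> (f has_derivative frechet_derivative f (at x)) (at x)"
    and "Ck_on k S (\<lambda>x. frechet_derivative f (at x) v)"
  using assms by (auto simp: frechet_derivative_works[symmetric])

lemma Ck_on_const: "open S \<Longrightarrow> Ck_on k S (\<lambda>x. c)"
  by (induction k arbitrary: c) (auto intro!: Ck_on_SucI derivative_eq_intros)

lemma Ck_on_linear:
  assumes "open S" "bounded_linear f"
  shows "Ck_on k S f"
proof (cases k)
  case 0
  then show ?thesis
    using assms by (simp add: linear_continuous_on)
next
  case (Suc m)
  show ?thesis unfolding Suc
    using assms by (intro Ck_on_SucI[where f' = "\<lambda>_. f"] bounded_linear_imp_has_derivative Ck_on_const)
qed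

lemma Ck_on_add:
  assumes "open S"
  shows "Ck_on k S f \<Longrightarrow> Ck_on k S g \<Longrightarrow> Ck_on k S (\<lambda>x. f x + g x)"
proof (induction k arbitrary: f g)
  case (Suc k)
  note f = Ck_on_SucE[OF Suc.prems(1)] and g = Ck_on_SucE[OF Suc.prems(2)]
  show ?case
  proof (rule Ck_on_SucI[OF assms])
    show "((\<lambda>x. f x + g x) has_derivative
        (\<lambda>v. frechet_derivative f (at x) v + frechet_derivative g (at x) v)) (at x)" if "x \<in> S" for x
      using f(1)[OF that] g(1)[OF that] by (rule has_derivative_add)
    show "Ck_on k S (\<lambda>x. frechet_derivative f (at x) v + frechet_derivative g (at x) v)" for v
      using f(2) g(2) by (rule Suc.IH)
  qed
qed (auto intro: continuous_intros)

lemma Ck_on_mult: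
  fixes f g :: "'a::real_normed_vector \<Rightarrow> real"
  assumes "open S"
  shows "Ck_on k S f \<Longrightarrow> Ck_on k S g \<Longrightarrow> Ck_on k S (\<lambda>x. f x * g x)"
proof (induction k arbitrary: f g)
  case (Suc k)
  note f = Ck_on_SucE[OF Suc.prems(1)] and g = Ck_on_SucE[OF Suc.prems(2)]
  show ?case
  proof (rule Ck_on_SucI[OF assms])
    show "((\<lambda>x. f x * g x) has_derivative
        (\<lambda>v. f x * frechet_derivative g (at x) v + frechet_derivative f (at x) v * g x)) (at x)"
      if "x \<in> S" for x
      using f(1)[OF that] g(1)[OF that] by (rule has_derivative_mult)
    show "Ck_on k S (\<lambda>x. f x * frechet_derivative g (at x) v + frechet_derivative f (at x) v * g x)" for v
      using Suc.prems by (intro Ck_on_add assms Suc.IH f(2) g(2)) (auto intro: Ck_on_SucD)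
  qed
qed (auto intro: continuous_intros)

lemma Ck_on_inverse:
  fixes f :: "'a::real_normed_vector \<Rightarrow> real"
  assumes "open S" "\<And>x. x \<in> S \<Longrightarrow> f x \<noteq> 0"
  shows "Ck_on k S f \<Longrightarrow> Ck_on k S (\<lambda>x. inverse (f x))"
proof (induction k)
  case (Suc k)
  note f = Ck_on_SucE[OF Suc.prems]
  show ?case
  proof (rule Ck_on_SucI[OF assms(1)])
    show "((\<lambda>x. inverse (f x)) has_derivative
        (\<lambda>v. (- 1) * (inverse (f x) * frechet_derivative f (at x) v * inverse (f x)))) (at x)"
      if "x \<in> S" for x
      using Deriv.has_derivative_inverse[OF assms(2)[OF that] f(1)[OF that]] by simp
    show "Ck_on k S (\<lambda>x. (- 1) * (inverse (f x) * frechet_derivative f (at x) v * inverse (f x)))" for v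
      using Suc.IH[OF Ck_on_SucD[OF Suc.prems]] by (intro Ck_on_mult Ck_on_const assms(1) f(2))
  qed
qed (use assms in \<open>auto intro: continuous_intros\<close>)

section \<open>Symmetry of second derivatives\<close>

text \<open>The mean value theorem is applied twice: in \<open>s\<close>, to the difference of
  \<open>f\<close> along opposite sides of the parallelogram, then in \<open>t\<close>, to the
  directional derivative along \<open>u\<close>.\<close>

lemma second_difference_mean_value:
  fixes f :: "'a::real_normed_vector \<Rightarrow> real"
  assumes "Ck_on (Suc (Suc 0)) S f" "h > 0"
    "\<And>s t. 0 \<le> s \<Longrightarrow> s \<le> h \<Longrightarrow> 0 \<le> t \<Longrightarrow> t \<le> h \<Longrightarrow> p + s *\<^sub>R u + t *\<^sub>R v \<in> S"
  obtains s t where "0 < s" "s < h" "0 < t" "t < h"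
    "f (p + h *\<^sub>R u + h *\<^sub>R v) - f (p + h *\<^sub>R u) - f (p + h *\<^sub>R v) + f p =
     h * (h * frechet_derivative (\<lambda>q. frechet_derivative f (at q) u) (at (p + s *\<^sub>R u + t *\<^sub>R v)) v)"
proof -
  let ?D = "\<lambda>q. frechet_derivative f (at q)"
  let ?E = "\<lambda>q. frechet_derivative (\<lambda>q. frechet_derivative f (at q) u) (at q)"
  have f: "((\<lambda>s. f (p + s *\<^sub>R u + t *\<^sub>R v)) has_real_derivative ?D (p + s *\<^sub>R u + t *\<^sub>R v) u) (at s)"
    if "0 \<le> s" "s \<le> h" "0 \<le> t" "t \<le> h" for s t
  proof -
    have "(f has_derivative ?D (p + s *\<^sub>R u + t *\<^sub>R v)) (at (p + s *\<^sub>R u + t *\<^sub>R v))"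
      using Ck_on_SucE(1)[OF assms(1)] assms(3) that by blast
    then have "((\<lambda>s. f (p + s *\<^sub>R u + t *\<^sub>R v)) has_derivative (\<lambda>r. ?D (p + s *\<^sub>R u + t *\<^sub>R v) (r *\<^sub>R u))) (at s)"
      by (rule has_derivative_compose[rotated]) (auto intro!: derivative_eq_intros)
    moreover have "linear (?D (p + s *\<^sub>R u + t *\<^sub>R v))"
      using assms(1,3) that by (auto intro: linear_frechet_derivative)
    ultimately show ?thesis
      by (simp add: has_field_derivative_def linear_cmul mult.commute[of _ "?D _ u"])
  qed
  have g: "((\<lambda>t. ?D (p + s *\<^sub>R u + t *\<^sub>R v) u) has_real_derivative ?E (p + s *\<^sub>R u + t *\<^sub>R v) v) (at t)"
    if "0 \<le> s" "s \<le> h" "0 \<le> t" "t \<le> h" for s t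
  proof -
    have "((\<lambda>q. ?D q u) has_derivative ?E (p + s *\<^sub>R u + t *\<^sub>R v)) (at (p + s *\<^sub>R u + t *\<^sub>R v))"
      using Ck_on_SucE(1)[OF Ck_on_SucE(2)[OF assms(1)]] assms(3) that by blast
    then have "((\<lambda>t. ?D (p + s *\<^sub>R u + t *\<^sub>R v) u) has_derivative (\<lambda>r. ?E (p + s *\<^sub>R u + t *\<^sub>R v) (r *\<^sub>R v))) (at t)"
      by (rule has_derivative_compose[rotated]) (auto intro!: derivative_eq_intros)
    moreover have "linear (?E (p + s *\<^sub>R u + t *\<^sub>R v))"
      using assms(1,3) that by (auto intro: linear_frechet_derivative)
    ultimately show ?thesis
      by (simp add: has_field_derivative_def linear_cmul mult.commute[of _ "?E _ v"])
  qed
  have "\<exists>s>0. s < h \<and> (f (p + h *\<^sub>R u + h *\<^sub>R v) - f (p + h *\<^sub>R u + 0 *\<^sub>R v)) -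
        (f (p + 0 *\<^sub>R u + h *\<^sub>R v) - f (p + 0 *\<^sub>R u + 0 *\<^sub>R v)) =
        (h - 0) * (?D (p + s *\<^sub>R u + h *\<^sub>R v) u - ?D (p + s *\<^sub>R u + 0 *\<^sub>R v) u)"
    by (rule MVT2[OF \<open>h > 0\<close>, where f = "\<lambda>s. f (p + s *\<^sub>R u + h *\<^sub>R v) - f (p + s *\<^sub>R u + 0 *\<^sub>R v)"])
       (use \<open>h > 0\<close> in \<open>auto intro!: DERIV_diff f f[where t = 0, simplified]\<close>)
  then obtain s where s: "0 < s" "s < h" and 1: "f (p + h *\<^sub>R u + h *\<^sub>R v) - f (p + h *\<^sub>R u)
       - f (p + h *\<^sub>R v) + f p = h * (?D (p + s *\<^sub>R u + h *\<^sub>R v) u - ?D (p + s *\<^sub>R u + 0 *\<^sub>R v) u)"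
    by auto
  have "\<exists>t>0. t < h \<and> ?D (p + s *\<^sub>R u + h *\<^sub>R v) u - ?D (p + s *\<^sub>R u + 0 *\<^sub>R v) u
      = (h - 0) * ?E (p + s *\<^sub>R u + t *\<^sub>R v) v"
    by (rule MVT2[OF \<open>h > 0\<close>]) (use s in \<open>auto intro!: g\<close>)
  then obtain t where "0 < t" "t < h" and 2: "?D (p + s *\<^sub>R u + h *\<^sub>R v) u - ?D (p + s *\<^sub>R u + 0 *\<^sub>R v) u
      = h * ?E (p + s *\<^sub>R u + t *\<^sub>R v) v"
    by auto
  with s 1 show ?thesis
    unfolding 2 by (intro that)
qed

text \<open>The second difference over a small parallelogram with sides along \<open>u\<close> and
  \<open>v\<close> is symmetric in the two, and its mean value forms are the two mixed derivatives
  at points near \<open>p\<close>. Continuity at \<open>p\<close> identifies them.\<close>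

lemma frechet_derivative_commute:
  fixes f :: "'a::real_normed_vector \<Rightarrow> real"
  assumes "open S" "p \<in> S" "Ck_on (Suc (Suc 0)) S f"
  shows "frechet_derivative (\<lambda>q. frechet_derivative f (at q) u) (at p) v =
         frechet_derivative (\<lambda>q. frechet_derivative f (at q) v) (at p) u"
proof -
  define A where "A u v q = frechet_derivative (\<lambda>q. frechet_derivative f (at q) u) (at q) v" for u v q
  have cont: "isCont (A u v) p" for u v
    using Ck_on_SucE(2)[OF Ck_on_SucE(2)[OF assms(3)]] assms(1,2)
    by (auto simp: A_def[abs_def] continuous_on_eq_continuous_at)
  have close: "\<exists>d>0. \<forall>q. dist q p < d \<longrightarrow> q \<in> S \<and> dist (A u v q) (A u v p) < e"
    if "e > 0" for e u v
  proof -
    obtain d1 where "d1 > 0" "\<And>q. dist q p < d1 \<Longrightarrow> dist (A u v q) (A u v p) < e"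
      using cont[of u v] \<open>e > 0\<close> unfolding continuous_at_eps_delta by blast
    moreover obtain d2 where "d2 > 0" "\<And>q. dist q p < d2 \<Longrightarrow> q \<in> S"
      using assms(1,2) by (auto simp: open_dist)
    ultimately show ?thesis
      by (intro exI[of _ "min d1 d2"]) auto
  qed
  have "dist (A u v p) (A v u p) < e" if "e > 0" for e
  proof -
    obtain d1 where d1: "d1 > 0" "\<And>q. dist q p < d1 \<Longrightarrow> q \<in> S"
        "\<And>q. dist q p < d1 \<Longrightarrow> dist (A u v q) (A u v p) < e / 2"
      using close[of "e/2" u v] \<open>e > 0\<close> by auto
    obtain d2 where d2: "d2 > 0" "\<And>q. dist q p < d2 \<Longrightarrow> dist (A v u q) (A v u p) < e / 2"
      using close[of "e/2" v u] \<open>e > 0\<close> by auto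
    \<comment> \<open>With the \<open>h\<close> that follows, the parallelogram stays within half of
      \<open>min d1 d2\<close> from \<open>p\<close>; the summand 1 keeps \<open>K\<close> positive
      even if \<open>u\<close> and \<open>v\<close> vanish.\<close>
    define K where "K = norm u + norm v + 1"
    define h where "h = min d1 d2 / (2 * K)"
    have "K > 0" unfolding K_def by (smt (verit) norm_ge_zero)
    have "h > 0" using d1(1) d2(1) \<open>K > 0\<close> by (simp add: h_def)
    have near: "dist (p + s *\<^sub>R u + t *\<^sub>R v) p < min d1 d2"
      if "0 \<le> s" "s \<le> h" "0 \<le> t" "t \<le> h" for s t
    proof -
      have "dist (p + s *\<^sub>R u + t *\<^sub>R v) p \<le> s * norm u + t * norm v"
        using that norm_triangle_ineq[of "s *\<^sub>R u" "t *\<^sub>R v"] by (simp add: dist_norm add.assoc)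
      also have "\<dots> \<le> h * norm u + h * norm v"
        using that by (intro add_mono mult_right_mono) auto
      also have "\<dots> \<le> h * K"
        using \<open>h > 0\<close> by (simp add: K_def algebra_simps)
      also have "\<dots> = min d1 d2 / 2"
        using \<open>K > 0\<close> by (simp add: h_def)
      also have "\<dots> < min d1 d2"
        using d1(1) d2(1) by (simp add: min_def)
      finally show ?thesis .
    qed
    obtain s t where st: "0 < s" "s < h" "0 < t" "t < h"
      "f (p + h *\<^sub>R u + h *\<^sub>R v) - f (p + h *\<^sub>R u) - f (p + h *\<^sub>R v) + f p =
         h * (h * A u v (p + s *\<^sub>R u + t *\<^sub>R v))"
      unfolding A_def
      by (rule second_difference_mean_value[OF assms(3) \<open>h > 0\<close>, of p u v])
         (use near d1(2) in auto)
    obtain s' t' where st': "0 < s'" "s' < h" "0 < t'" "t' < h"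
      "f (p + h *\<^sub>R v + h *\<^sub>R u) - f (p + h *\<^sub>R v) - f (p + h *\<^sub>R u) + f p =
         h * (h * A v u (p + s' *\<^sub>R v + t' *\<^sub>R u))"
      unfolding A_def
    proof (rule second_difference_mean_value[OF assms(3) \<open>h > 0\<close>, of p v u])
      fix s t assume "0 \<le> s" "s \<le> h" "0 \<le> t" "t \<le> h"
      then show "p + s *\<^sub>R v + t *\<^sub>R u \<in> S"
        using near[of t s] d1(2) by (auto simp: add_ac)
    qed auto
    have "h * (h * A u v (p + s *\<^sub>R u + t *\<^sub>R v)) = h * (h * A v u (p + s' *\<^sub>R v + t' *\<^sub>R u))"
      using st(5) st'(5) by (simp add: algebra_simps)
    then have "A u v (p + s *\<^sub>R u + t *\<^sub>R v) = A v u (p + t' *\<^sub>R u + s' *\<^sub>R v)"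
      using \<open>h > 0\<close> by (simp add: add_ac)
    moreover have "dist (A u v (p + s *\<^sub>R u + t *\<^sub>R v)) (A u v p) < e / 2"
      using st near by (intro d1(3)) auto
    moreover have "dist (A v u (p + t' *\<^sub>R u + s' *\<^sub>R v)) (A v u p) < e / 2"
      using st' near by (intro d2(2)) auto
    ultimately show ?thesis
      by (smt (verit) dist_commute dist_triangle_half_l field_sum_of_halves dist_triangle2)
  qed
  then have "A u v p = A v u p"
    by (metis dist_self dist_pos_lt less_irrefl)
  then show ?thesis by (simp add: A_def)
qed

subsection \<open>Partial derivatives on the slit tangent bundle\<close>

text \<open>A Finsler function is in general not differentiable on the zero section, so smoothness
  is asked only at y \<noteq> 0.\<close>

definition slit_smooth :: "(real ^ 'n) set \<Rightarrow> (real ^ 'n \<Rightarrow> real ^ 'n::finite \<Rightarrow> real) \<Rightarrow> bool" where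
  "slit_smooth U F \<longleftrightarrow> smooth_on (U \<times> (- {0})) (\<lambda>(x, y). F x y)"

locale slit_bundle =
  fixes U :: "(real ^ 'n::finite) set"
  assumes open_base: "open U"
begin

abbreviation sm :: "(real ^ 'n \<Rightarrow> real ^ 'n \<Rightarrow> real) \<Rightarrow> bool" where
  "sm \<equiv> slit_smooth U"

lemma open_slit: "open (U \<times> (- {0 :: real ^ 'n}))"
  using open_base by (intro open_Times) auto

lemma sm_cong:
  assumes "\<And>x y. x \<in> U \<Longrightarrow> y \<noteq> 0 \<Longrightarrow> F x y = G x y" "sm F"
  shows "sm G"
  using assms Ck_on_cong[OF open_slit, of "\<lambda>(x, y). F x y" "\<lambda>(x, y). G x y"]
  by (auto simp: slit_smooth_def smooth_on_def)

lemma sm_const: "sm (\<lambda>x y. c)"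
  using Ck_on_const[OF open_slit] by (auto simp: slit_smooth_def smooth_on_def case_prod_unfold)

lemma sm_coord: "sm (\<lambda>x y. y $ i)"
  unfolding slit_smooth_def smooth_on_def case_prod_unfold
  by (intro allI Ck_on_linear[OF open_slit] bounded_linear_compose[OF bounded_linear_vec_nth bounded_linear_snd])

lemma sm_add: "sm F \<Longrightarrow> sm G \<Longrightarrow> sm (\<lambda>x y. F x y + G x y)"
  using Ck_on_add[OF open_slit, of _ "\<lambda>(x, y). F x y" "\<lambda>(x, y). G x y"]
  by (auto simp: slit_smooth_def smooth_on_def case_prod_unfold)

lemma sm_mult: "sm F \<Longrightarrow> sm G \<Longrightarrow> sm (\<lambda>x y. F x y * G x y)"
  using Ck_on_mult[OF open_slit, of _ "\<lambda>(x, y). F x y" "\<lambda>(x, y). G x y"]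
  by (auto simp: slit_smooth_def smooth_on_def case_prod_unfold)

lemma sm_inverse: "sm F \<Longrightarrow> (\<And>x y. x \<in> U \<Longrightarrow> y \<noteq> 0 \<Longrightarrow> F x y \<noteq> 0) \<Longrightarrow> sm (\<lambda>x y. inverse (F x y))"
  using Ck_on_inverse[OF open_slit, of "\<lambda>(x, y). F x y"]
  by (auto simp: slit_smooth_def smooth_on_def case_prod_unfold)

lemma sm_cmult: "sm F \<Longrightarrow> sm (\<lambda>x y. c * F x y)"
  by (intro sm_mult sm_const)

lemma sm_diff: "sm F \<Longrightarrow> sm G \<Longrightarrow> sm (\<lambda>x y. F x y - G x y)"
  using sm_add[of F "\<lambda>x y. (- 1) * G x y"] sm_cmult[of G "- 1"] by simp

lemma sm_cdiv: "sm F \<Longrightarrow> sm (\<lambda>x y. F x y / c)"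
  using sm_cmult[of F "inverse c"] by (simp add: divide_inverse mult.commute)

lemma sm_divide:
  "sm F \<Longrightarrow> sm G \<Longrightarrow> (\<And>x y. x \<in> U \<Longrightarrow> y \<noteq> 0 \<Longrightarrow> G x y \<noteq> 0) \<Longrightarrow> sm (\<lambda>x y. F x y / G x y)"
  unfolding divide_inverse by (intro sm_mult sm_inverse)

lemma sm_sum: "(\<And>i. i \<in> A \<Longrightarrow> sm (F i)) \<Longrightarrow> sm (\<lambda>x y. \<Sum>i\<in>A. F i x y)"
  by (induction A rule: infinite_finite_induct) (auto intro: sm_const sm_add)

lemma sm_prod: "(\<And>i. i \<in> A \<Longrightarrow> sm (F i)) \<Longrightarrow> sm (\<lambda>x y. \<Prod>i\<in>A. F i x y)"
  by (induction A rule: infinite_finite_induct) (auto intro: sm_const sm_mult)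

lemma sm_det:
  fixes A :: "'k::finite \<Rightarrow> 'k \<Rightarrow> real ^ 'n \<Rightarrow> real ^ 'n \<Rightarrow> real"
  assumes "\<And>i j. sm (A i j)"
  shows "sm (\<lambda>x y. det (\<chi> i j. A i j x y))"
  unfolding det_def by (auto intro!: sm_sum sm_cmult sm_prod assms)

lemma sm_power2: "sm F \<Longrightarrow> sm (\<lambda>x y. (F x y)\<^sup>2)"
  by (simp add: power2_eq_square sm_mult)

lemmas sm_intros = sm_add sm_mult sm_diff sm_cdiv sm_sum sm_coord sm_power2 sm_const

lemma sm_has_derivative:
  assumes "sm F" "x \<in> U" "y \<noteq> 0"
  shows "((\<lambda>(x, y). F x y) has_derivative frechet_derivative (\<lambda>(x, y). F x y) (at (x, y))) (at (x, y))"
proof -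
  have "Ck_on (Suc 0) (U \<times> (- {0})) (\<lambda>(x, y). F x y)"
    using assms(1) unfolding slit_smooth_def smooth_on_def by blast
  from Ck_on_SucE(1)[OF this, of "(x, y)"] show ?thesis
    using assms by simp
qed

text \<open>Axis directions turn this chain rule into formulas for \<open>dx\<close> and
  \<open>dy\<close>; the direction \<open>(0, y)\<close> gives the radial derivative in Euler's
  theorem.\<close>

lemma sm_has_real_derivative:
  assumes "sm F" "x \<in> U" "y \<noteq> 0"
  shows "((\<lambda>t. F (x + t *\<^sub>R u) (y + t *\<^sub>R v)) has_real_derivative
    frechet_derivative (\<lambda>(x, y). F x y) (at (x, y)) (u, v)) (at 0)"
proof -
  let ?D = "frechet_derivative (\<lambda>(x, y). F x y) (at (x, y))"
  have "((\<lambda>t. (x + t *\<^sub>R u, y + t *\<^sub>R v)) has_derivative (\<lambda>t. t *\<^sub>R (u, v))) (at (0 :: real))"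
    by (auto intro!: derivative_eq_intros simp: scaleR_prod_def)
  then have "((\<lambda>t. (\<lambda>(x, y). F x y) (x + t *\<^sub>R u, y + t *\<^sub>R v)) has_derivative (\<lambda>t. ?D (t *\<^sub>R (u, v)))) (at 0)"
    by (rule has_derivative_compose) (use sm_has_derivative[OF assms] in simp)
  moreover have "linear ?D"
    using sm_has_derivative[OF assms] has_derivative_linear by blast
  ultimately show ?thesis
    by (simp add: has_field_derivative_def linear_cmul mult.commute[of _ "?D _"] del: scaleR_Pair)
qed

lemma dx_frechet:
  "sm F \<Longrightarrow> x \<in> U \<Longrightarrow> y \<noteq> 0 \<Longrightarrow>
    dx k F x y = frechet_derivative (\<lambda>(x, y). F x y) (at (x, y)) (axis k 1, 0)"
  unfolding dx_def using sm_has_real_derivative[of F x y "axis k 1" 0] by (intro DERIV_imp_deriv) simp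

lemma dy_frechet:
  "sm F \<Longrightarrow> x \<in> U \<Longrightarrow> y \<noteq> 0 \<Longrightarrow>
    dy k F x y = frechet_derivative (\<lambda>(x, y). F x y) (at (x, y)) (0, axis k 1)"
  unfolding dy_def using sm_has_real_derivative[of F x y 0 "axis k 1"] by (intro DERIV_imp_deriv) simp

lemma sm_DERIV_dx:
  "sm F \<Longrightarrow> x \<in> U \<Longrightarrow> y \<noteq> 0 \<Longrightarrow> ((\<lambda>t. F (x + t *\<^sub>R axis k 1) y) has_real_derivative dx k F x y) (at 0)"
  using sm_has_real_derivative[of F x y "axis k 1" 0] dx_frechet[of F x y k] by simp

lemma sm_DERIV_dy:
  "sm F \<Longrightarrow> x \<in> U \<Longrightarrow> y \<noteq> 0 \<Longrightarrow> ((\<lambda>t. F x (y + t *\<^sub>R axis k 1)) has_real_derivative dy k F x y) (at 0)"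
  using sm_has_real_derivative[of F x y 0 "axis k 1"] dy_frechet[of F x y k] by simp

lemma sm_frechet: "sm F \<Longrightarrow> sm (\<lambda>x y. frechet_derivative (\<lambda>(x, y). F x y) (at (x, y)) v)"
  unfolding slit_smooth_def smooth_on_def
  using Ck_on_SucE(2)[where f = "\<lambda>(x, y). F x y" and v = v and S = "U \<times> (- {0})"]
  by (auto simp: case_prod_unfold simp del: Ck_on.simps)

lemma sm_dx: "sm F \<Longrightarrow> sm (dx k F)"
  by (rule sm_cong[OF _ sm_frechet[where v = "(axis k 1, 0)"]]) (simp_all add: dx_frechet)

lemma sm_dy: "sm F \<Longrightarrow> sm (dy k F)"
  by (rule sm_cong[OF _ sm_frechet[where v = "(0, axis k 1)"]]) (simp_all add: dy_frechet)

lemma frechet_cong: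
  assumes "\<And>x y. x \<in> U \<Longrightarrow> y \<noteq> 0 \<Longrightarrow> F x y = G x y" "sm F" "x \<in> U" "y \<noteq> 0"
  shows "frechet_derivative (\<lambda>(x, y). F x y) (at (x, y)) = frechet_derivative (\<lambda>(x, y). G x y) (at (x, y))"
proof (rule frechet_derivative_transform_within_open[OF _ open_slit])
  show "(\<lambda>(x, y). F x y) differentiable at (x, y)"
    using sm_has_derivative[OF assms(2-4)] by (auto simp: differentiable_def)
qed (use assms in auto)

lemma dx_cong:
  assumes "\<And>x y. x \<in> U \<Longrightarrow> y \<noteq> 0 \<Longrightarrow> F x y = G x y" "sm F" "x \<in> U" "y \<noteq> 0"
  shows "dx k F x y = dx k G x y"
  using frechet_cong[OF assms] assms sm_cong[OF assms(1,2)] by (simp add: dx_frechet)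

lemma dy_cong:
  assumes "\<And>x y. x \<in> U \<Longrightarrow> y \<noteq> 0 \<Longrightarrow> F x y = G x y" "sm F" "x \<in> U" "y \<noteq> 0"
  shows "dy k F x y = dy k G x y"
  using frechet_cong[OF assms] assms sm_cong[OF assms(1,2)] by (simp add: dy_frechet)

lemma frechet_commute:
  assumes "sm F" "x \<in> U" "y \<noteq> 0"
  shows "frechet_derivative (\<lambda>(x, y). frechet_derivative (\<lambda>(x, y). F x y) (at (x, y)) u) (at (x, y)) v =
    frechet_derivative (\<lambda>(x, y). frechet_derivative (\<lambda>(x, y). F x y) (at (x, y)) v) (at (x, y)) u"
proof -
  have "Ck_on (Suc (Suc 0)) (U \<times> (- {0})) (\<lambda>(x, y). F x y)"
    using assms(1) unfolding slit_smooth_def smooth_on_def by blast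
  from frechet_derivative_commute[OF open_slit _ this, of "(x, y)" u v] show ?thesis
    using assms by (simp add: case_prod_unfold)
qed

lemma dy_dx_frechet:
  assumes "sm F" "x \<in> U" "y \<noteq> 0"
  shows "dy j (dx i F) x y =
    frechet_derivative (\<lambda>(x, y). frechet_derivative (\<lambda>(x, y). F x y) (at (x, y)) (axis i 1, 0)) (at (x, y)) (0, axis j 1)"
  using assms frechet_cong[of "dx i F" "\<lambda>x y. frechet_derivative (\<lambda>(x, y). F x y) (at (x, y)) (axis i 1, 0)"]
  by (simp add: sm_dx dx_frechet dy_frechet)

lemma dx_dy_frechet:
  assumes "sm F" "x \<in> U" "y \<noteq> 0"
  shows "dx i (dy j F) x y =
    frechet_derivative (\<lambda>(x, y). frechet_derivative (\<lambda>(x, y). F x y) (at (x, y)) (0, axis j 1)) (at (x, y)) (axis i 1, 0)"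
  using assms frechet_cong[of "dy j F" "\<lambda>x y. frechet_derivative (\<lambda>(x, y). F x y) (at (x, y)) (0, axis j 1)"]
  by (simp add: sm_dy dx_frechet dy_frechet)

lemma dy_dy_frechet:
  assumes "sm F" "x \<in> U" "y \<noteq> 0"
  shows "dy i (dy j F) x y =
    frechet_derivative (\<lambda>(x, y). frechet_derivative (\<lambda>(x, y). F x y) (at (x, y)) (0, axis j 1)) (at (x, y)) (0, axis i 1)"
  using assms frechet_cong[of "dy j F" "\<lambda>x y. frechet_derivative (\<lambda>(x, y). F x y) (at (x, y)) (0, axis j 1)"]
  by (simp add: sm_dy dy_frechet)

lemma dy_dx_commute:
  "sm F \<Longrightarrow> x \<in> U \<Longrightarrow> y \<noteq> 0 \<Longrightarrow> dy j (dx i F) x y = dx i (dy j F) x y"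
  by (simp add: dy_dx_frechet dx_dy_frechet frechet_commute)

lemma dy_dy_commute:
  "sm F \<Longrightarrow> x \<in> U \<Longrightarrow> y \<noteq> 0 \<Longrightarrow> dy i (dy j F) x y = dy j (dy i F) x y"
  by (simp add: dy_dy_frechet frechet_commute)

lemma dy_const: "dy k (\<lambda>x y. f x) x y = 0"
  by (simp add: dy_def)

lemma dx_const: "dx k (\<lambda>x y. c) x y = 0"
  by (simp add: dx_def)

lemma dx_coord: "dx k (\<lambda>x y. y $ i) x y = 0"
  by (simp add: dx_def)

lemma dy_coord: "dy k (\<lambda>x y. y $ i) x y = (if i = k then 1 else 0)"
proof -
  have "((\<lambda>t. (y + t *\<^sub>R axis k 1) $ i) has_real_derivative axis k 1 $ i) (at 0)"
    by (auto intro!: derivative_eq_intros)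
  then show ?thesis
    unfolding dy_def by (auto dest!: DERIV_imp_deriv simp: axis_def)
qed

section \<open>Rules for partial derivatives and Euler's theorem\<close>

context
  fixes x y :: "real ^ 'n"
  assumes xy: "x \<in> U" "y \<noteq> 0"
begin

lemma dx_add: "sm F \<Longrightarrow> sm G \<Longrightarrow> dx k (\<lambda>x y. F x y + G x y) x y = dx k F x y + dx k G x y"
  unfolding dx_def[of k "\<lambda>x y. F x y + G x y"]
  by (intro DERIV_imp_deriv DERIV_add sm_DERIV_dx xy)

lemma dy_add: "sm F \<Longrightarrow> sm G \<Longrightarrow> dy k (\<lambda>x y. F x y + G x y) x y = dy k F x y + dy k G x y"
  unfolding dy_def[of k "\<lambda>x y. F x y + G x y"]
  by (intro DERIV_imp_deriv DERIV_add sm_DERIV_dy xy)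

lemma dx_diff: "sm F \<Longrightarrow> sm G \<Longrightarrow> dx k (\<lambda>x y. F x y - G x y) x y = dx k F x y - dx k G x y"
  unfolding dx_def[of k "\<lambda>x y. F x y - G x y"]
  by (intro DERIV_imp_deriv DERIV_diff sm_DERIV_dx xy)

lemma dy_diff: "sm F \<Longrightarrow> sm G \<Longrightarrow> dy k (\<lambda>x y. F x y - G x y) x y = dy k F x y - dy k G x y"
  unfolding dy_def[of k "\<lambda>x y. F x y - G x y"]
  by (intro DERIV_imp_deriv DERIV_diff sm_DERIV_dy xy)

lemma dx_mult: "sm F \<Longrightarrow> sm G \<Longrightarrow>
    dx k (\<lambda>x y. F x y * G x y) x y = dx k F x y * G x y + F x y * dx k G x y"
  unfolding dx_def[of k "\<lambda>x y. F x y * G x y"]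
  using DERIV_mult[OF sm_DERIV_dx[OF _ xy, of F k] sm_DERIV_dx[OF _ xy, of G k]]
  by (intro DERIV_imp_deriv) (simp add: algebra_simps)

lemma dy_mult: "sm F \<Longrightarrow> sm G \<Longrightarrow>
    dy k (\<lambda>x y. F x y * G x y) x y = dy k F x y * G x y + F x y * dy k G x y"
  unfolding dy_def[of k "\<lambda>x y. F x y * G x y"]
  using DERIV_mult[OF sm_DERIV_dy[OF _ xy, of F k] sm_DERIV_dy[OF _ xy, of G k]]
  by (intro DERIV_imp_deriv) (simp add: algebra_simps)

lemma dx_cmult: "sm F \<Longrightarrow> dx k (\<lambda>x y. c * F x y) x y = c * dx k F x y"
  by (simp add: dx_mult sm_const dx_const)

lemma dy_cmult: "sm F \<Longrightarrow> dy k (\<lambda>x y. c * F x y) x y = c * dy k F x y"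
  by (simp add: dy_mult sm_const dy_const)

lemma dx_cdiv: "sm F \<Longrightarrow> dx k (\<lambda>x y. F x y / c) x y = dx k F x y / c"
  unfolding dx_def[of k "\<lambda>x y. F x y / c"]
  by (intro DERIV_imp_deriv DERIV_cdivide sm_DERIV_dx xy)

lemma dy_cdiv: "sm F \<Longrightarrow> dy k (\<lambda>x y. F x y / c) x y = dy k F x y / c"
  unfolding dy_def[of k "\<lambda>x y. F x y / c"]
  by (intro DERIV_imp_deriv DERIV_cdivide sm_DERIV_dy xy)

lemma dx_sum: "(\<And>i. i \<in> A \<Longrightarrow> sm (F i)) \<Longrightarrow> dx k (\<lambda>x y. \<Sum>i\<in>A. F i x y) x y = (\<Sum>i\<in>A. dx k (F i) x y)"
  unfolding dx_def[of k "\<lambda>x y. \<Sum>i\<in>A. F i x y"]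
  by (intro DERIV_imp_deriv DERIV_sum sm_DERIV_dx xy)

lemma dy_sum: "(\<And>i. i \<in> A \<Longrightarrow> sm (F i)) \<Longrightarrow> dy k (\<lambda>x y. \<Sum>i\<in>A. F i x y) x y = (\<Sum>i\<in>A. dy k (F i) x y)"
  unfolding dy_def[of k "\<lambda>x y. \<Sum>i\<in>A. F i x y"]
  by (intro DERIV_imp_deriv DERIV_sum sm_DERIV_dy xy)

lemma dy_power2: "sm F \<Longrightarrow> dy k (\<lambda>x y. (F x y)\<^sup>2) x y = 2 * F x y * dy k F x y"
  by (simp add: power2_eq_square dy_mult)

text \<open>The derivative at \<open>t = 0\<close> of
  \<open>F x (y + t *\<^sub>R y) = (1 + t) ^ m * F x y\<close> is computed in two ways. Homogeneity
  holds for positive factors, hence the restriction to \<open>t > -1\<close>.\<close>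

lemma euler_homogeneous:
  assumes "sm F" "\<And>t. t > 0 \<Longrightarrow> F x (t *\<^sub>R y) = t ^ m * F x y"
  shows "(\<Sum>k\<in>UNIV. y $ k * dy k F x y) = real m * F x y"
proof -
  let ?D = "frechet_derivative (\<lambda>(x, y). F x y) (at (x, y))"
  have lin: "linear ?D"
    using sm_has_derivative[OF assms(1) xy] has_derivative_linear by blast
  have "((\<lambda>t. F x (y + t *\<^sub>R y)) has_real_derivative ?D (0, y)) (at 0)"
    using sm_has_real_derivative[OF assms(1) xy, of 0 y] by simp
  moreover have "((\<lambda>t. F x (y + t *\<^sub>R y)) has_real_derivative real m * F x y) (at 0)"
  proof (rule has_field_derivative_transform_within_open)
    show "((\<lambda>t. (1 + t) ^ m * F x y) has_real_derivative real m * F x y) (at 0)"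
      by (auto intro!: derivative_eq_intros)
    show "(1 + t) ^ m * F x y = F x (y + t *\<^sub>R y)" if "t \<in> {-1<..}" for t
      using assms(2)[of "1 + t"] that by (simp add: scaleR_left_distrib)
  qed auto
  ultimately have "?D (0, y) = real m * F x y"
    by (rule DERIV_unique)
  moreover have "(0, y) = (\<Sum>k\<in>UNIV. y $ k *\<^sub>R (0 :: real ^ 'n, axis k 1 :: real ^ 'n))"
  proof -
    have "y = (\<Sum>k\<in>UNIV. y $ k *\<^sub>R axis k 1)"
      by (simp add: vec_eq_iff axis_def if_distrib cong: if_cong)
    then show ?thesis
      by (simp add: prod_eq_iff fst_sum snd_sum)
  qed
  ultimately show ?thesis
    using dy_frechet[OF assms(1) xy] by (simp add: linear_sum[OF lin] linear_cmul[OF lin] del: scaleR_Pair)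
qed

end

end

subsection \<open>The Cartan connection of one Finsler function\<close>

lemma sum_mult_2: "(\<Sum>i\<in>A. f i * (2 * h i)) = 2 * (\<Sum>i\<in>A. f i * h i)" for f h :: "'a \<Rightarrow> real"
  by (simp add: sum_distrib_left mult_ac)

lemma sum_mult_swap:
  "(\<Sum>i\<in>A. f i * (\<Sum>j\<in>B. h i j * k j)) = (\<Sum>j\<in>B. k j * (\<Sum>i\<in>A. f i * h i j))"
  for f :: "'a \<Rightarrow> real"
  by (simp add: sum_distrib_left mult_ac sum.swap[of _ A B])

lemma sum_mult_swap':
  "(\<Sum>i\<in>A. f i * (\<Sum>j\<in>B. k j * h i j)) = (\<Sum>j\<in>B. k j * (\<Sum>i\<in>A. f i * h i j))"
  for f :: "'a \<Rightarrow> real"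
  using sum_mult_swap[of f h k B A] by (simp add: mult.commute)

locale finsler_chart = slit_bundle U for U :: "(real ^ 'n::finite) set" +
  fixes F :: "real ^ 'n \<Rightarrow> real ^ 'n \<Rightarrow> real"
  assumes sm_F: "sm F"
    and homogeneous: "x \<in> U \<Longrightarrow> t > 0 \<Longrightarrow> F x (t *\<^sub>R y) = t * F x y"
    and pos: "x \<in> U \<Longrightarrow> y \<noteq> 0 \<Longrightarrow> F x y > 0"
    and metric_posdef: "x \<in> U \<Longrightarrow> y \<noteq> 0 \<Longrightarrow> v \<noteq> 0 \<Longrightarrow>
      (\<Sum>i\<in>UNIV. \<Sum>j\<in>UNIV. metric F i j x y * v $ i * v $ j) > 0"
begin

abbreviation "P r \<equiv> dy r (sq F)"
abbreviation "g \<equiv> metric F"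
abbreviation "S \<equiv> spray F"
abbreviation "N \<equiv> nonlin F"

lemma sm_Q: "sm (sq F)"
  by (intro sm_power2 sm_F)

lemma sm_P: "sm (P r)"
  by (intro sm_dy sm_Q)

lemma sm_g: "sm (g i j)"
  unfolding metric_def[abs_def] by (intro sm_cdiv sm_dy sm_P)

lemma dy_P: "dy i (P j) = (\<lambda>x y. 2 * g i j x y)"
  by (simp add: metric_def fun_eq_iff)

lemma metric_sym: "x \<in> U \<Longrightarrow> y \<noteq> 0 \<Longrightarrow> g i j x y = g j i x y"
  unfolding metric_def by (simp add: dy_dy_commute sm_Q)

text \<open>Contracting the equation once more with \<open>v\<close> gives the value 0 of the
  quadratic form, which positive definiteness excludes for nonzero \<open>v\<close>.\<close>

lemma metric_kernel:
  assumes "x \<in> U" "y \<noteq> 0" "\<And>r. (\<Sum>i\<in>UNIV. g r i x y * v i) = 0"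
  shows "v i = 0"
proof (rule ccontr)
  assume "v i \<noteq> 0"
  then have "(\<chi> j. v j) \<noteq> 0"
    by (auto simp: vec_eq_iff)
  from metric_posdef[OF assms(1,2) this]
  have "0 < (\<Sum>r\<in>UNIV. \<Sum>j\<in>UNIV. v r * (g r j x y * v j))"
    by (simp add: mult_ac)
  also have "\<dots> = 0"
    by (simp add: sum_distrib_left[symmetric] assms(3))
  finally show False by simp
qed

text \<open>Objects with an upper index are compared below after lowering it, which avoids computing
  with the inverse metric.\<close>

lemma metric_cancel:
  assumes "x \<in> U" "y \<noteq> 0" "\<And>r. (\<Sum>i\<in>UNIV. g r i x y * v i) = (\<Sum>i\<in>UNIV. g r i x y * w i)"
  shows "v i = w i"
  using metric_kernel[OF assms(1,2), of "\<lambda>i. v i - w i" i] assms(3)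
  by (simp add: right_diff_distrib sum_subtractf)

lemma metric_invertible:
  assumes "x \<in> U" "y \<noteq> 0"
  shows "invertible (\<chi> k l. g k l x y)"
proof -
  have "v = 0" if "(\<chi> k l. g k l x y) *v v = 0" for v
  proof -
    have "(\<Sum>i\<in>UNIV. g r i x y * v $ i) = 0" for r
      using that by (simp add: matrix_vector_mult_def vec_eq_iff)
    from metric_kernel[OF assms this] show ?thesis
      by (simp add: vec_eq_iff)
  qed
  then show ?thesis
    by (simp add: invertible_left_inverse matrix_left_invertible_ker)
qed

lemma metric_mult_inv:
  assumes "x \<in> U" "y \<noteq> 0"
  shows "(\<Sum>i\<in>UNIV. g r i x y * metric_inv F i s x y) = (if r = s then 1 else 0)"
proof -
  let ?A = "\<chi> k l. g k l x y"
  have "?A ** matrix_inv ?A = mat 1"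
    using someI_ex[OF metric_invertible[OF assms, unfolded invertible_def]] by (simp add: matrix_inv_def)
  then have "(?A ** matrix_inv ?A) $ r $ s = mat 1 $ r $ s" by simp
  then show ?thesis
    by (simp add: matrix_matrix_mult_def metric_inv_def mat_def)
qed

lemma metric_inv_solve:
  assumes "x \<in> U" "y \<noteq> 0"
  shows "(\<Sum>i\<in>UNIV. g r i x y * (\<Sum>s\<in>UNIV. metric_inv F i s x y * w s)) = w r"
proof -
  have "(\<Sum>i\<in>UNIV. g r i x y * (\<Sum>s\<in>UNIV. metric_inv F i s x y * w s)) =
    (\<Sum>s\<in>UNIV. \<Sum>i\<in>UNIV. w s * (g r i x y * metric_inv F i s x y))"
    by (subst sum.swap) (simp add: sum_distrib_left mult_ac)
  also have "\<dots> = w r"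
    by (simp add: sum_distrib_left[symmetric] metric_mult_inv[OF assms] if_distrib cong: if_cong)
  finally show ?thesis .
qed

text \<open>Column \<open>s\<close> of the inverse solves \<open>A v = axis s 1\<close>, so by
  Cramer's rule its entries are quotients of determinants, which are polynomials in smooth
  functions.\<close>

lemma sm_metric_inv: "sm (metric_inv F i s)"
proof -
  define A where "A x y = (\<chi> k l. g k l x y)" for x y
  \<comment> \<open>Cramer's numerator: \<open>A\<close> with column \<open>i\<close> replaced by
    the unit vector at \<open>s\<close>.\<close>
  define B where "B x y = (\<chi> k l. (if l = i then if k = s then 1 else 0 else g k l x y))" for x y
  have inv: "invertible (A x y)" if "x \<in> U" "y \<noteq> 0" for x y
    using metric_invertible that by (simp add: A_def)
  show ?thesis
  proof (rule sm_cong)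
    show "sm (\<lambda>x y. det (B x y) / det (A x y))"
    proof (rule sm_divide)
      show "sm (\<lambda>x y. det (A x y))"
        unfolding A_def by (intro sm_det sm_g)
      have "sm (\<lambda>x y. if l = i then if k = s then 1 else 0 else g k l x y)" for k l
        by (cases "l = i"; cases "k = s") (simp_all add: sm_g sm_const)
      then show "sm (\<lambda>x y. det (B x y))"
        unfolding B_def by (intro sm_det)
      show "det (A x y) \<noteq> 0" if "x \<in> U" "y \<noteq> 0" for x y
        using inv[OF that] by (simp add: invertible_det_nz)
    qed
    fix x y :: "real ^ 'n" assume xy: "x \<in> U" "y \<noteq> 0"
    have "A x y *v (\<chi> i. metric_inv F i s x y) = axis s 1"
      using metric_mult_inv[OF xy] by (simp add: A_def matrix_vector_mult_def vec_eq_iff axis_def)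
    then have "(\<chi> i. metric_inv F i s x y) =
        (\<chi> k. det (\<chi> i j. if j = k then axis s 1 $ i else A x y $ i $ j) / det (A x y))"
      using cramer inv[OF xy] invertible_det_nz by blast
    moreover have "B x y = (\<chi> k j. if j = i then axis s 1 $ k else A x y $ k $ j)"
      by (simp add: vec_eq_iff B_def A_def axis_def)
    ultimately show "det (B x y) / det (A x y) = metric_inv F i s x y"
      by (metis (no_types, lifting) vec_lambda_beta)
  qed
qed

lemma sm_S: "sm (S i)"
proof -
  have "sm (\<lambda>x y. 1/2 * (\<Sum>r\<in>UNIV. metric_inv F i r x y *
      ((\<Sum>k\<in>UNIV. y $ k * dx k (P r) x y) - dx r (sq F) x y)))"
    by (intro sm_intros sm_metric_inv sm_dx sm_dy sm_P sm_Q)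
  then show ?thesis
    by (simp add: spray_def[abs_def])
qed

lemma sm_N: "sm (N i j)"
  unfolding nonlin_def[abs_def] by (intro sm_cdiv sm_dy sm_S)

lemma dy_S: "dy j (S i) x y = 2 * N i j x y"
  by (simp add: nonlin_def)

lemmas smooth = sm_intros sm_dx sm_dy sm_F sm_Q sm_P sm_g sm_S sm_N

section \<open>Horizontal derivatives and homogeneity identities\<close>

context
  fixes x y :: "real ^ 'n"
  assumes xy: "x \<in> U" "y \<noteq> 0"
begin

lemmas dx_rules = dx_cmult[OF xy] dx_cdiv[OF xy] dx_add[OF xy] dx_diff[OF xy] dx_mult[OF xy]
  dx_sum[OF xy] dx_coord dx_const
lemmas dy_rules = dy_cmult[OF xy] dy_cdiv[OF xy] dy_add[OF xy] dy_diff[OF xy] dy_mult[OF xy]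
  dy_sum[OF xy] dy_coord dy_const

lemma hdelta_mult: "sm H \<Longrightarrow> sm K \<Longrightarrow>
    hdelta F k (\<lambda>x y. H x y * K x y) x y = hdelta F k H x y * K x y + H x y * hdelta F k K x y"
  by (simp add: hdelta_def dx_rules dy_rules algebra_simps sum.distrib sum_distrib_left)

lemma hdelta_add: "sm H \<Longrightarrow> sm K \<Longrightarrow>
    hdelta F k (\<lambda>x y. H x y + K x y) x y = hdelta F k H x y + hdelta F k K x y"
  by (simp add: hdelta_def dx_rules dy_rules algebra_simps sum.distrib)

lemma hdelta_diff: "sm H \<Longrightarrow> sm K \<Longrightarrow>
    hdelta F k (\<lambda>x y. H x y - K x y) x y = hdelta F k H x y - hdelta F k K x y"
  by (simp add: hdelta_def dx_rules dy_rules algebra_simps sum_subtractf)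

lemma hdelta_const: "hdelta F k (\<lambda>x y. c) x y = 0"
  by (simp add: hdelta_def dx_const dy_const)

lemma hdelta_cmult: "sm H \<Longrightarrow> hdelta F k (\<lambda>x y. c * H x y) x y = c * hdelta F k H x y"
  by (simp add: hdelta_mult sm_const hdelta_const)

lemma hdelta_cdiv: "sm H \<Longrightarrow> hdelta F k (\<lambda>x y. H x y / c) x y = hdelta F k H x y / c"
  using hdelta_cmult[of H k "inverse c"] by (simp add: field_simps)

lemma hdelta_sum: "(\<And>i. i \<in> A \<Longrightarrow> sm (H i)) \<Longrightarrow>
    hdelta F k (\<lambda>x y. \<Sum>i\<in>A. H i x y) x y = (\<Sum>i\<in>A. hdelta F k (H i) x y)"
  by (induction A rule: infinite_finite_induct) (simp_all add: hdelta_const hdelta_add sm_sum)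

lemma hdelta_coord: "hdelta F k (\<lambda>x y. y $ i) x y = - N i k x y"
  by (simp add: hdelta_def dx_coord dy_coord if_distrib cong: if_cong)

lemmas hdelta_rules = hdelta_cmult hdelta_cdiv hdelta_add hdelta_diff hdelta_mult
  hdelta_sum hdelta_coord hdelta_const

lemma hdelta_cong:
  assumes "\<And>x y. x \<in> U \<Longrightarrow> y \<noteq> 0 \<Longrightarrow> H x y = K x y" "sm H"
  shows "hdelta F k H x y = hdelta F k K x y"
  unfolding hdelta_def using dx_cong[OF assms xy] dy_cong[OF assms xy] by simp

text \<open>Both sides are half of a third \<open>y\<close>-derivative of \<open>F^2\<close>, so the
  derivatives may be reordered. With the symmetry of \<open>g\<close> this is the total symmetry of
  the Cartan tensor.\<close>

lemma dy_metric_sym: "dy k (g i j) x y = dy i (g k j) x y"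
  unfolding metric_def[abs_def] using dy_dy_commute[OF sm_P xy, of k i j]
  by (simp add: dy_rules smooth)

lemma euler_Q: "(\<Sum>k\<in>UNIV. y $ k * P k x y) = 2 * (F x y)\<^sup>2"
  using euler_homogeneous[OF xy sm_Q, of 2] homogeneous[OF xy(1)] by (simp add: power_mult_distrib)

end

context
  fixes x y :: "real ^ 'n"
  assumes xy: "x \<in> U" "y \<noteq> 0"
begin

text \<open>\<open>euler_Q\<close> is differentiated by \<open>y^i\<close>. Closing and reopening
  the context makes it available at every point of the slit bundle, as differentiation requires;
  several later contexts are split for the same reason.\<close>

lemma euler_P: "(\<Sum>k\<in>UNIV. y $ k * g i k x y) = P i x y / 2"
proof -
  have "dy i (\<lambda>x y. \<Sum>k\<in>UNIV. y $ k * P k x y) x y = dy i (\<lambda>x y. 2 * (F x y)\<^sup>2) x y"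
    by (rule dy_cong[OF _ _ xy]) (simp_all add: euler_Q smooth)
  then show ?thesis
    by (simp add: dy_rules[OF xy] smooth dy_P sum.distrib if_distrib[of "\<lambda>c. c * _"] sum_mult_2 cong: if_cong)
qed

end

context
  fixes x y :: "real ^ 'n"
  assumes xy: "x \<in> U" "y \<noteq> 0"
begin

text \<open>The metric is homogeneous of degree 0 in \<open>y\<close>. This comes from
  differentiating \<open>euler_P\<close> and moving the derivative to the contracted index by
  symmetry of the Cartan tensor.\<close>

lemma euler_metric: "(\<Sum>k\<in>UNIV. y $ k * dy k (g i j) x y) = 0"
proof -
  have "dy i (\<lambda>x y. \<Sum>k\<in>UNIV. y $ k * g j k x y) x y = dy i (\<lambda>x y. P j x y / 2) x y"
    by (rule dy_cong[OF _ _ xy]) (simp_all add: euler_P smooth)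
  moreover have "dy i (g j k) x y = dy k (g i j) x y" for k
  proof -
    have "dy i (g j k) x y = dy i (g k j) x y"
      by (rule dy_cong[OF metric_sym _ xy]) (simp_all add: smooth)
    then show ?thesis
      using dy_metric_sym[OF xy] by simp
  qed
  ultimately show ?thesis
    by (simp add: dy_rules[OF xy] smooth dy_P sum.distrib if_distrib[of "\<lambda>c. c * _"] metric_sym[OF xy, of i j]
         cong: if_cong)
qed

lemma spray_eq: "(\<Sum>i\<in>UNIV. g r i x y * S i x y) = ((\<Sum>k\<in>UNIV. y $ k * dx k (P r) x y) - dx r (sq F) x y) / 2"
proof -
  have S: "S i x y = (\<Sum>r\<in>UNIV. metric_inv F i r x y *
      (((\<Sum>k\<in>UNIV. y $ k * dx k (dy r (sq F)) x y) - dx r (sq F) x y) / 2))" for i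
    by (simp add: spray_def sum_divide_distrib)
  show ?thesis
    unfolding S by (rule metric_inv_solve[OF xy])
qed

end

context
  fixes x y :: "real ^ 'n"
  assumes xy: "x \<in> U" "y \<noteq> 0"
begin

text \<open>This is \<open>spray_eq\<close> differentiated by \<open>y^k\<close>. Its part
  antisymmetric in \<open>k\<close> and \<open>r\<close> yields \<open>hdelta_P\<close>, its
  symmetric part yields \<open>hdelta_metric_along\<close>.\<close>

lemma spray_eq_deriv:
  "(\<Sum>i\<in>UNIV. dy k (g r i) x y * S i x y) + 2 * (\<Sum>i\<in>UNIV. g r i x y * N i k x y) =
    (dx k (P r) x y - dx r (P k) x y) / 2 + (\<Sum>j\<in>UNIV. y $ j * dx j (g k r) x y)"
proof -
  have "dy k (\<lambda>x y. \<Sum>i\<in>UNIV. g r i x y * S i x y) x y =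
      dy k (\<lambda>x y. ((\<Sum>k\<in>UNIV. y $ k * dx k (P r) x y) - dx r (sq F) x y) / 2) x y"
    by (rule dy_cong[OF _ _ xy]) (simp_all add: spray_eq smooth)
  moreover have "dy k (dx j (P r)) x y = 2 * dx j (g k r) x y" for j
    by (simp add: dy_dx_commute[OF _ xy] smooth dy_P dx_rules[OF xy])
  moreover have "dy k (dx r (sq F)) x y = dx r (P k) x y"
    by (simp add: dy_dx_commute[OF _ xy] smooth)
  ultimately have "(\<Sum>i\<in>UNIV. dy k (g r i) x y * S i x y) + 2 * (\<Sum>i\<in>UNIV. g r i x y * N i k x y) =
      (dx k (P r) x y + 2 * (\<Sum>j\<in>UNIV. y $ j * dx j (g k r) x y) - dx r (P k) x y) / 2"
    by (simp add: dy_rules[OF xy] smooth dy_S dy_P sum.distrib if_distrib[of "\<lambda>c. c * _"] sum_mult_2 cong: if_cong)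
  then show ?thesis
    by (simp add: field_simps)
qed

text \<open>The spray is homogeneous of degree 2. Here this follows by contracting
  \<open>spray_eq_deriv\<close> with \<open>y^k\<close>: the vertical derivative of the metric drops
  out by \<open>euler_metric\<close>, and the \<open>x\<close>-derivatives of the Euler identities
  reduce the rest to \<open>spray_eq\<close>.\<close>

lemma euler_spray: "(\<Sum>k\<in>UNIV. N s k x y * y $ k) = S s x y"
proof (rule metric_cancel[OF xy])
  fix r
  have 1: "(\<Sum>k\<in>UNIV. y $ k * (\<Sum>i\<in>UNIV. dy k (g r i) x y * S i x y)) = 0"
  proof -
    have "(\<Sum>k\<in>UNIV. y $ k * (\<Sum>i\<in>UNIV. dy k (g r i) x y * S i x y)) =
      (\<Sum>i\<in>UNIV. S i x y * (\<Sum>k\<in>UNIV. y $ k * dy k (g r i) x y))"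
      by (rule sum_mult_swap)
    then show ?thesis by (simp add: euler_metric[OF xy])
  qed
  have 2: "(\<Sum>k\<in>UNIV. y $ k * dx r (P k) x y) = 2 * dx r (sq F) x y"
  proof -
    have "dx r (\<lambda>x y. \<Sum>k\<in>UNIV. y $ k * P k x y) x y = dx r (\<lambda>x y. 2 * (F x y)\<^sup>2) x y"
      by (rule dx_cong[OF _ _ xy]) (simp_all add: euler_Q smooth)
    then show ?thesis by (simp add: dx_rules[OF xy] smooth)
  qed
  have 3: "(\<Sum>k\<in>UNIV. y $ k * dx j (g k r) x y) = dx j (P r) x y / 2" for j
  proof -
    have "dx j (\<lambda>x y. \<Sum>k\<in>UNIV. y $ k * g k r x y) x y = dx j (\<lambda>x y. P r x y / 2) x y"
      by (rule dx_cong[OF _ _ xy]) (simp_all add: euler_P[symmetric] smooth metric_sym[of _ _ _ r])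
    then show ?thesis by (simp add: dx_rules[OF xy] smooth)
  qed
  have 4: "(\<Sum>k\<in>UNIV. y $ k * (\<Sum>j\<in>UNIV. y $ j * dx j (g k r) x y)) = (\<Sum>j\<in>UNIV. y $ j * dx j (P r) x y) / 2"
  proof -
    have "(\<Sum>k\<in>UNIV. y $ k * (\<Sum>j\<in>UNIV. y $ j * dx j (g k r) x y)) =
       (\<Sum>j\<in>UNIV. y $ j * (\<Sum>k\<in>UNIV. y $ k * dx j (g k r) x y))"
      by (rule sum_mult_swap')
    then show ?thesis by (simp add: 3 sum_divide_distrib)
  qed
  have "2 * (\<Sum>k\<in>UNIV. y $ k * (\<Sum>i\<in>UNIV. g r i x y * N i k x y)) =
      (\<Sum>k\<in>UNIV. y $ k * ((\<Sum>i\<in>UNIV. dy k (g r i) x y * S i x y) + 2 * (\<Sum>i\<in>UNIV. g r i x y * N i k x y)))"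
    by (simp add: distrib_left sum.distrib 1 sum_mult_2)
  also have "\<dots> = ((\<Sum>k\<in>UNIV. y $ k * dx k (P r) x y) - (\<Sum>k\<in>UNIV. y $ k * dx r (P k) x y)) / 2 +
      (\<Sum>k\<in>UNIV. y $ k * (\<Sum>j\<in>UNIV. y $ j * dx j (g k r) x y))"
    unfolding spray_eq_deriv by (simp add: distrib_left right_diff_distrib diff_divide_distrib sum.distrib sum_subtractf sum_divide_distrib)
  also have "\<dots> = 2 * (\<Sum>i\<in>UNIV. g r i x y * S i x y)"
    unfolding 2 4 spray_eq[OF xy] by (simp add: field_simps)
  finally have "(\<Sum>k\<in>UNIV. y $ k * (\<Sum>i\<in>UNIV. g r i x y * N i k x y)) = (\<Sum>i\<in>UNIV. g r i x y * S i x y)"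
    by simp
  moreover have "(\<Sum>k\<in>UNIV. y $ k * (\<Sum>i\<in>UNIV. g r i x y * N i k x y)) =
      (\<Sum>i\<in>UNIV. g r i x y * (\<Sum>k\<in>UNIV. N i k x y * y $ k))"
    by (simp add: sum_distrib_left mult_ac) (rule sum.swap)
  ultimately show "(\<Sum>i\<in>UNIV. g r i x y * (\<Sum>k\<in>UNIV. N i k x y * y $ k)) = (\<Sum>i\<in>UNIV. g r i x y * S i x y)"
    by simp
qed

end

end

section \<open>Metricity and parallel tensors of the Cartan connection\<close>

context finsler_chart
begin

context
  fixes x y :: "real ^ 'n"
  assumes xy: "x \<in> U" "y \<noteq> 0"
begin

lemma hdelta_metric_sym: "hdelta F k (g i j) x y = hdelta F k (g j i) x y"
  by (rule hdelta_cong[OF xy metric_sym sm_g])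

lemma dy_metric_sym': "dy k (g i j) x y = dy k (g j i) x y"
  by (rule dy_cong[OF metric_sym sm_g xy])

text \<open>Subtracting \<open>spray_eq_deriv\<close> with \<open>k\<close> and \<open>r\<close>
  exchanged cancels the symmetric terms; what is left says that the \<open>N\<close>-terms
  compensate the asymmetry of \<open>dx k (P r)\<close>.\<close>

lemma hdelta_P: "hdelta F k (P r) x y = hdelta F r (P k) x y"
proof -
  have "dy k (g r i) x y = dy r (g k i) x y" for i
    by (rule dy_metric_sym[OF xy])
  moreover have "dx j (g k r) x y = dx j (g r k) x y" for j
    by (rule dx_cong[OF metric_sym sm_g xy])
  ultimately have "2 * (\<Sum>i\<in>UNIV. g r i x y * N i k x y) - 2 * (\<Sum>i\<in>UNIV. g k i x y * N i r x y)
      = dx k (P r) x y - dx r (P k) x y"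
    using spray_eq_deriv[OF xy, of k r] spray_eq_deriv[OF xy, of r k] by (simp add: field_simps)
  moreover have "(\<Sum>s\<in>UNIV. N s k x y * dy s (P r) x y) = 2 * (\<Sum>i\<in>UNIV. g r i x y * N i k x y)" for k r
    by (simp add: dy_P sum_mult_2 metric_sym[OF xy, of _ r] mult.commute)
  ultimately show ?thesis
    by (simp add: hdelta_def)
qed

text \<open>Adding the two exchanged instances of \<open>spray_eq_deriv\<close> gives the
  \<open>dx\<close>-part. In the vertical part \<open>N\<close> contracts to the spray by
  \<open>euler_spray\<close>, and this cancels the term with the derivative of the metric.\<close>

lemma hdelta_metric_along:
  "(\<Sum>j\<in>UNIV. y $ j * hdelta F j (g r k) x y) =
    (\<Sum>i\<in>UNIV. g r i x y * N i k x y) + (\<Sum>i\<in>UNIV. g k i x y * N i r x y)"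
proof -
  have "dy k (g r i) x y = dy r (g k i) x y" for i
    by (rule dy_metric_sym[OF xy])
  moreover have "dx j (g k r) x y = dx j (g r k) x y" for j
    by (rule dx_cong[OF metric_sym sm_g xy])
  ultimately have 1: "(\<Sum>j\<in>UNIV. y $ j * dx j (g r k) x y) = (\<Sum>i\<in>UNIV. dy r (g k i) x y * S i x y)
      + (\<Sum>i\<in>UNIV. g r i x y * N i k x y) + (\<Sum>i\<in>UNIV. g k i x y * N i r x y)"
    using spray_eq_deriv[OF xy, of k r] spray_eq_deriv[OF xy, of r k] by (simp add: field_simps)
  have "(\<Sum>j\<in>UNIV. y $ j * (\<Sum>s\<in>UNIV. N s j x y * dy s (g r k) x y)) =
      (\<Sum>s\<in>UNIV. dy s (g r k) x y * (\<Sum>j\<in>UNIV. y $ j * N s j x y))"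
    by (rule sum_mult_swap)
  also have "\<dots> = (\<Sum>s\<in>UNIV. dy s (g r k) x y * S s x y)"
    using euler_spray[OF xy] by (simp add: mult.commute)
  also have "\<dots> = (\<Sum>s\<in>UNIV. dy r (g k s) x y * S s x y)"
    using dy_metric_sym[OF xy] dy_metric_sym' by metis
  finally show ?thesis
    using 1 by (simp add: hdelta_def right_diff_distrib sum_subtractf)
qed

lemma cartan_lowered:
  "(\<Sum>i\<in>UNIV. g r i x y * cartan F i j k x y) =
    (hdelta F j (g r k) x y + hdelta F k (g r j) x y - hdelta F r (g j k) x y) / 2"
proof -
  have C: "cartan F i j k x y = (\<Sum>r\<in>UNIV. metric_inv F i r x y *
      ((hdelta F j (g r k) x y + hdelta F k (g r j) x y - hdelta F r (g j k) x y) / 2))" for i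
    by (simp add: cartan_def sum_divide_distrib)
  show ?thesis
    unfolding C by (rule metric_inv_solve[OF xy])
qed

lemma cartan_sym: "cartan F i j k x y = cartan F i k j x y"
  by (simp add: cartan_def hdelta_metric_sym[of _ j k] add.commute)

text \<open>As for the Levi-Civita connection, adding two instances of the first-kind formula
  \<open>cartan_lowered\<close> cancels all horizontal derivatives but one.\<close>

lemma metric_parallel:
  "hdelta F k (g i j) x y =
    (\<Sum>r\<in>UNIV. g r j x y * cartan F r i k x y) + (\<Sum>r\<in>UNIV. g i r x y * cartan F r j k x y)"
  using cartan_lowered[of j i k] cartan_lowered[of i j k]
  by (simp add: metric_sym[OF xy, of _ j] hdelta_metric_sym[of _ j i] field_simps)

text \<open>The lowered formula contracts to three terms. \<open>hdelta_metric_along\<close>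
  evaluates the first and the local fact \<open>P\<close> the others, whose derivatives of
  \<open>P\<close> cancel by \<open>hdelta_P\<close>. So the Cartan coefficients determine
  \<open>N\<close>; in covariant terms, \<open>y\<close> is parallel.\<close>

lemma euler_cartan: "(\<Sum>j\<in>UNIV. y $ j * cartan F i j k x y) = N i k x y"
proof (rule metric_cancel[OF xy, of "\<lambda>i. \<Sum>j\<in>UNIV. y $ j * cartan F i j k x y" "\<lambda>i. N i k x y"])
  fix r
  \<comment> \<open>\<open>euler_P\<close> is differentiated horizontally; the term with
    \<open>N\<close> arises because \<open>hdelta F k\<close> sends the coordinate
    \<open>y^j\<close> to \<open>- N j k\<close>.\<close>
  have P: "(\<Sum>j\<in>UNIV. y $ j * hdelta F k (g r j) x y) = hdelta F k (P r) x y / 2 + (\<Sum>j\<in>UNIV. g r j x y * N j k x y)" for k r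
  proof -
    have "hdelta F k (\<lambda>x y. \<Sum>j\<in>UNIV. y $ j * g r j x y) x y = hdelta F k (\<lambda>x y. P r x y / 2) x y"
      by (rule hdelta_cong[OF xy euler_P]) (simp_all add: smooth)
    then show ?thesis
      by (simp add: hdelta_rules[OF xy] smooth sum.distrib sum_negf sum_subtractf mult.commute)
  qed
  have "(\<Sum>i\<in>UNIV. g r i x y * (\<Sum>j\<in>UNIV. y $ j * cartan F i j k x y)) =
      (\<Sum>j\<in>UNIV. y $ j * (\<Sum>i\<in>UNIV. g r i x y * cartan F i j k x y))"
    by (rule sum_mult_swap')
  also have "\<dots> = ((\<Sum>j\<in>UNIV. y $ j * hdelta F j (g r k) x y) + (\<Sum>j\<in>UNIV. y $ j * hdelta F k (g r j) x y)
      - (\<Sum>j\<in>UNIV. y $ j * hdelta F r (g k j) x y)) / 2"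
    unfolding cartan_lowered hdelta_metric_sym[of r k]
    by (simp add: sum_divide_distrib diff_divide_distrib add_divide_distrib right_diff_distrib distrib_left sum.distrib sum_subtractf)
  also have "\<dots> = (\<Sum>i\<in>UNIV. g r i x y * N i k x y)"
    unfolding hdelta_metric_along P hdelta_P[of r k] by simp
  finally show "(\<Sum>i\<in>UNIV. g r i x y * (\<Sum>j\<in>UNIV. y $ j * cartan F i j k x y)) = (\<Sum>i\<in>UNIV. g r i x y * N i k x y)" .
qed

text \<open>By \<open>euler_P\<close>, half of \<open>P i\<close> is the contraction of the parallel
  metric with \<open>y\<close>, which is parallel by \<open>euler_cartan\<close>.\<close>

lemma hdelta_P_parallel: "hdelta F k (P i) x y = (\<Sum>r\<in>UNIV. P r x y * cartan F r i k x y)"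
proof -
  have "hdelta F k (P i) x y / 2 = hdelta F k (\<lambda>x y. P i x y / 2) x y"
    by (simp add: hdelta_rules[OF xy] smooth)
  also have "\<dots> = hdelta F k (\<lambda>x y. \<Sum>j\<in>UNIV. y $ j * g i j x y) x y"
    by (rule hdelta_cong[OF xy euler_P[symmetric]]) (simp_all add: smooth)
  also have "\<dots> = (\<Sum>j\<in>UNIV. y $ j * hdelta F k (g i j) x y) - (\<Sum>j\<in>UNIV. g i j x y * N j k x y)"
    by (simp add: hdelta_rules[OF xy] smooth sum.distrib sum_negf sum_subtractf mult.commute)
  also have "(\<Sum>j\<in>UNIV. y $ j * hdelta F k (g i j) x y) =
      (\<Sum>j\<in>UNIV. y $ j * (\<Sum>r\<in>UNIV. g r j x y * cartan F r i k x y)) +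
      (\<Sum>j\<in>UNIV. y $ j * (\<Sum>r\<in>UNIV. g i r x y * cartan F r j k x y))"
    by (simp add: metric_parallel distrib_left sum.distrib)
  also have "(\<Sum>j\<in>UNIV. y $ j * (\<Sum>r\<in>UNIV. g r j x y * cartan F r i k x y)) =
      (\<Sum>r\<in>UNIV. cartan F r i k x y * (\<Sum>j\<in>UNIV. y $ j * g r j x y))"
    by (rule sum_mult_swap)
  also have "(\<Sum>j\<in>UNIV. y $ j * (\<Sum>r\<in>UNIV. g i r x y * cartan F r j k x y)) =
      (\<Sum>r\<in>UNIV. g i r x y * (\<Sum>j\<in>UNIV. y $ j * cartan F r j k x y))"
    by (rule sum_mult_swap')
  finally show ?thesis
    by (simp add: euler_P[OF xy] euler_cartan mult.commute sum_divide_distrib[symmetric])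
qed

text \<open>By \<open>euler_Q\<close>, \<open>2 F^2\<close> is the contraction of the parallel
  covector \<open>P\<close> with the parallel vector \<open>y\<close>.\<close>

lemma hdelta_Q: "hdelta F k (sq F) x y = 0"
proof -
  have "hdelta F k (\<lambda>x y. 2 * (F x y)\<^sup>2) x y = hdelta F k (\<lambda>x y. \<Sum>j\<in>UNIV. y $ j * P j x y) x y"
    by (rule hdelta_cong[OF xy euler_Q[symmetric]]) (simp_all add: smooth)
  also have "\<dots> = (\<Sum>j\<in>UNIV. y $ j * hdelta F k (P j) x y) - (\<Sum>j\<in>UNIV. P j x y * N j k x y)"
    by (simp add: hdelta_rules[OF xy] smooth sum.distrib sum_negf sum_subtractf mult.commute)
  also have "(\<Sum>j\<in>UNIV. y $ j * hdelta F k (P j) x y) = (\<Sum>r\<in>UNIV. P r x y * (\<Sum>j\<in>UNIV. y $ j * cartan F r j k x y))"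
    unfolding hdelta_P_parallel by (rule sum_mult_swap')
  finally show ?thesis
    by (simp add: euler_cartan hdelta_rules[OF xy] smooth)
qed

lemma hdelta_F: "hdelta F k F x y = 0"
  using hdelta_Q[of k] hdelta_mult[OF xy sm_F sm_F, of k] pos[OF xy]
  by (simp add: power2_eq_square)

end

context
  fixes x y :: "real ^ 'n"
  assumes xy: "x \<in> U" "y \<noteq> 0"
begin

text \<open>\<open>P i = 2 F dy i F\<close> is parallel, and its positive factor \<open>F\<close> is
  horizontally constant and can be divided out.\<close>

lemma hdelta_dy_F: "hdelta F k (dy i F) x y = (\<Sum>r\<in>UNIV. dy r F x y * cartan F r i k x y)"
proof -
  have P: "P i x y = 2 * (F x y * dy i F x y)" if "x \<in> U" "y \<noteq> 0" for i x y
    using dy_power2[OF that sm_F] by simp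
  have "hdelta F k (P i) x y = hdelta F k (\<lambda>x y. 2 * (F x y * dy i F x y)) x y"
    by (rule hdelta_cong[OF xy P sm_P])
  also have "\<dots> = 2 * F x y * hdelta F k (dy i F) x y"
    by (simp add: hdelta_rules[OF xy] smooth hdelta_F[OF xy])
  finally show ?thesis
    using pos[OF xy] unfolding hdelta_P_parallel[OF xy]
    by (simp add: P[OF xy] mult.assoc sum_distrib_left[symmetric])
qed

text \<open>The second summand is the angular metric tensor. The decomposition is useful because
  \<open>dy i F\<close> and \<open>dy i (dy j F)\<close> change in a simple way under a
  \<beta>-conformal change.\<close>

lemma metric_dy_F: "g i j x y = dy i F x y * dy j F x y + F x y * dy i (dy j F) x y"
proof -
  have "dy i (P j) x y = dy i (\<lambda>x y. 2 * (F x y * dy j F x y)) x y"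
    by (rule dy_cong[OF _ sm_P xy]) (simp add: dy_power2 sm_F)
  then show ?thesis
    unfolding dy_P by (simp add: dy_rules[OF xy] smooth)
qed

end

end

subsection \<open>Comparison of two Finsler functions\<close>

locale finsler_pair = F: finsler_chart U F + G: finsler_chart U G
  for U :: "(real ^ 'n::finite) set" and F G
begin

text \<open>The spray of \<open>G\<close> is the only one whose horizontal lift annihilates \<open>G\<close>: contracting
  \<open>\<partial>\<^sub>k G\<^sup>2 = N\<^sup>s\<^sub>k \<partial>\<^sub>s G\<^sup>2\<close> with \<open>y\<^sup>k\<close> and differentiating by \<open>y\<close> gives back the spray equation.\<close>

lemma spray_unique:
  assumes par: "\<And>k x y. x \<in> U \<Longrightarrow> y \<noteq> 0 \<Longrightarrow> hdelta F k (sq G) x y = 0"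
    and xy: "x \<in> U" "y \<noteq> 0"
  shows "spray G i x y = spray F i x y"
proof (rule G.metric_cancel[OF xy])
  fix r
  have h: "dx k (sq G) x y = (\<Sum>s\<in>UNIV. F.N s k x y * G.P s x y)" if "x \<in> U" "y \<noteq> 0" for k x y
    using par[OF that, of k] by (simp add: hdelta_def)
  have c: "(\<Sum>k\<in>UNIV. y $ k * dx k (sq G) x y) = (\<Sum>s\<in>UNIV. G.P s x y * F.S s x y)"
    if "x \<in> U" "y \<noteq> 0" for x y
  proof -
    have "(\<Sum>k\<in>UNIV. y $ k * dx k (sq G) x y) = (\<Sum>k\<in>UNIV. y $ k * (\<Sum>s\<in>UNIV. F.N s k x y * G.P s x y))"
      by (simp add: h that)
    also have "\<dots> = (\<Sum>s\<in>UNIV. G.P s x y * (\<Sum>k\<in>UNIV. y $ k * F.N s k x y))"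
      by (rule sum_mult_swap)
    finally show ?thesis
      using F.euler_spray[OF that] by (simp add: mult.commute)
  qed
  have "dy r (\<lambda>x y. \<Sum>k\<in>UNIV. y $ k * dx k (sq G) x y) x y = dy r (\<lambda>x y. \<Sum>s\<in>UNIV. G.P s x y * F.S s x y) x y"
    by (rule F.dy_cong[OF c _ xy]) (simp_all add: G.smooth)
  then have "dx r (sq G) x y + (\<Sum>k\<in>UNIV. y $ k * dx k (G.P r) x y) =
      2 * (\<Sum>s\<in>UNIV. G.g r s x y * F.S s x y) + 2 * (\<Sum>s\<in>UNIV. F.N s r x y * G.P s x y)"
    by (simp add: F.dy_rules[OF xy] F.smooth G.smooth sum.distrib if_distrib[of "\<lambda>c. c * _"]
        F.dy_S G.dy_P sum_distrib_left F.dy_dx_commute[OF _ xy] mult.assoc mult.commute mult.left_commute cong: if_cong)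
  \<comment> \<open>By \<open>h\<close> the last sum is \<open>dx r (sq G)\<close>; what remains is
    the lowered spray equation of \<open>G\<close>, with the spray of \<open>F\<close> as its
    solution.\<close>
  then show "(\<Sum>i\<in>UNIV. G.g r i x y * G.S i x y) = (\<Sum>i\<in>UNIV. G.g r i x y * F.S i x y)"
    unfolding G.spray_eq[OF xy] h[OF xy, symmetric] by (simp add: field_simps)
qed

text \<open>\<open>N\<close> is half the \<open>y\<close>-derivative of the spray, so equality of
  the sprays on the whole slit bundle gives equality of the nonlinear connections.\<close>

lemma hdelta_unique:
  assumes "\<And>k x y. x \<in> U \<Longrightarrow> y \<noteq> 0 \<Longrightarrow> hdelta F k (sq G) x y = 0" "x \<in> U" "y \<noteq> 0"
  shows "hdelta G k H x y = hdelta F k H x y"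
proof -
  have "nonlin G i j x y = nonlin F i j x y" for i j
    unfolding nonlin_def using F.dy_cong[OF spray_unique G.sm_S] assms by simp
  then show ?thesis by (simp add: hdelta_def)
qed

text \<open>This is the uniqueness of a symmetric metrical connection: the horizontal derivatives
  coincide, and inserting the parallelism of \<open>metric G\<close> into the first-kind formula of
  \<open>G\<close> leaves the lowered coefficients of \<open>F\<close>.\<close>

lemma cartan_unique:
  assumes xy: "x \<in> U" "y \<noteq> 0"
    and h: "\<And>k x y. x \<in> U \<Longrightarrow> y \<noteq> 0 \<Longrightarrow> hdelta F k (sq G) x y = 0"
    and m: "\<And>i j k. hdelta F k (metric G i j) x y = (\<Sum>r\<in>UNIV. metric G r j x y * cartan F r i k x y)
      + (\<Sum>r\<in>UNIV. metric G i r x y * cartan F r j k x y)"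
  shows "cartan G i j k x y = cartan F i j k x y"
proof (rule G.metric_cancel[OF xy, of "\<lambda>i. cartan G i j k x y" "\<lambda>i. cartan F i j k x y"])
  fix r
  have m': "hdelta G k (metric G i j) x y = (\<Sum>r\<in>UNIV. metric G j r x y * cartan F r i k x y)
      + (\<Sum>r\<in>UNIV. metric G i r x y * cartan F r j k x y)" for i j k
    using m[of k i j] hdelta_unique[OF h xy] by (simp add: G.metric_sym[OF xy, of _ j])
  show "(\<Sum>i\<in>UNIV. G.g r i x y * cartan G i j k x y) = (\<Sum>i\<in>UNIV. G.g r i x y * cartan F i j k x y)"
    unfolding G.cartan_lowered[OF xy] m' F.cartan_sym[OF xy, of _ k j] F.cartan_sym[OF xy, of _ r j] F.cartan_sym[OF xy, of _ r k]
    by simp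
qed

end

section \<open>The two metric functions of a \<beta>-conformal change\<close>

text \<open>\<open>e\<close> stands for the exponential of \<sigma>. It and \<open>b\<close> are
  treated as functions constant in \<open>y\<close>, so that the calculus on the slit bundle covers
  them.\<close>

locale beta_conformal_pair = finsler_pair U F G for U :: "(real ^ 'n::finite) set" and F G +
  fixes e :: "real ^ 'n \<Rightarrow> real" and b :: "real ^ 'n \<Rightarrow> real ^ 'n"
  assumes sm_e: "F.sm (\<lambda>x y. e x)"
    and sm_b: "F.sm (\<lambda>x y. b x $ i)"
    and G_eq: "x \<in> U \<Longrightarrow> G x y = e x * F x y + (\<Sum>i\<in>UNIV. b x $ i * y $ i)"
begin

lemmas smooth = F.smooth G.smooth sm_e sm_b

lemma hdelta_e: "hdelta F k (\<lambda>x y. e x) x y = dx k (\<lambda>x y. e x) x y"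
  by (simp add: hdelta_def F.dy_const)

context
  fixes x y :: "real ^ 'n"
  assumes xy: "x \<in> U" "y \<noteq> 0"
begin

lemma dy_G: "dy i G x y = e x * dy i F x y + b x $ i"
proof -
  have "dy i G x y = dy i (\<lambda>x y. e x * F x y + (\<Sum>i\<in>UNIV. b x $ i * y $ i)) x y"
    by (rule F.dy_cong[OF G_eq G.sm_F xy])
  then show ?thesis
    by (simp add: F.dy_rules[OF xy] smooth F.dy_const if_distrib[of "\<lambda>c. _ * c"] cong: if_cong)
qed

end

context
  fixes x y :: "real ^ 'n"
  assumes xy: "x \<in> U" "y \<noteq> 0"
begin

lemma dy_dy_G: "dy i (dy j G) x y = e x * dy i (dy j F) x y"
proof -
  have "dy i (dy j G) x y = dy i (\<lambda>x y. e x * dy j F x y + b x $ j) x y"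
    by (rule F.dy_cong[OF dy_G _ xy]) (simp_all add: smooth)
  then show ?thesis
    by (simp add: F.dy_rules[OF xy] smooth F.dy_const)
qed

text \<open>The last two summands are the covariant derivative of \<open>dy i G\<close> for the
  connection of \<open>F\<close>: since \<open>dy i F\<close> is parallel, only derivatives of
  \<open>e\<close> and \<open>b\<close> contribute.\<close>

lemma hdelta_dy_G:
  "hdelta F k (dy i G) x y = (\<Sum>r\<in>UNIV. dy r G x y * cartan F r i k x y)
    + dx k (\<lambda>x y. e x) x y * dy i F x y + hcov F b i k x y"
proof -
  have "hdelta F k (dy i G) x y = hdelta F k (\<lambda>x y. e x * dy i F x y + b x $ i) x y"
    by (rule F.hdelta_cong[OF xy dy_G]) (simp_all add: smooth)
  also have "\<dots> = dx k (\<lambda>x y. e x) x y * dy i F x y + e x * (\<Sum>r\<in>UNIV. dy r F x y * cartan F r i k x y)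
      + hdelta F k (\<lambda>x y. b x $ i) x y"
    by (simp add: F.hdelta_rules[OF xy] smooth F.hdelta_dy_F[OF xy] hdelta_e)
  also have "\<dots> = (\<Sum>r\<in>UNIV. (e x * dy r F x y + b x $ r) * cartan F r i k x y)
      + dx k (\<lambda>x y. e x) x y * dy i F x y + hcov F b i k x y"
    by (simp add: hcov_def distrib_right sum.distrib sum_distrib_left mult.assoc)
  finally show ?thesis
    by (simp add: dy_G[OF xy])
qed

text \<open>Equal coefficients contract by \<open>euler_cartan\<close> to equal \<open>N\<close>, so
  both covariant derivatives agree. As \<open>dy i G\<close> is parallel for \<open>G\<close>, its
  derivative computed in \<open>hdelta_dy_G\<close> vanishes.\<close>

lemma cartan_eq_imp:
  assumes "\<And>i j k. cartan G i j k x y = cartan F i j k x y"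
  shows "dx k (\<lambda>x y. e x) x y * dy i F x y + hcov F b i k x y = 0"
proof -
  have "nonlin G i k x y = nonlin F i k x y" for i k
    unfolding F.euler_cartan[OF xy, symmetric] G.euler_cartan[OF xy, symmetric] assms ..
  then have "hdelta F k (dy i G) x y = hdelta G k (dy i G) x y"
    by (simp add: hdelta_def)
  then show ?thesis
    unfolding hdelta_dy_G G.hdelta_dy_F[OF xy] assms by simp
qed

end

text \<open>\<open>cartan_unique\<close> applies because \<open>G\<close> and its metric are built
  from objects parallel for \<open>F\<close>: \<open>e\<close>, \<open>b\<close>, \<open>y\<close>,
  \<open>F\<close>, \<open>dy i F\<close> and \<open>metric F\<close>.\<close>

lemma cartan_eqI:
  assumes e: "\<And>k x y. x \<in> U \<Longrightarrow> y \<noteq> 0 \<Longrightarrow> dx k (\<lambda>x y. e x) x y = 0"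
    and b: "\<And>i k x y. x \<in> U \<Longrightarrow> y \<noteq> 0 \<Longrightarrow> hcov F b i k x y = 0"
    and xy: "x \<in> U" "y \<noteq> 0"
  shows "cartan G i j k x y = cartan F i j k x y"
proof (rule cartan_unique[OF xy])
  have G0: "hdelta F k G x y = 0" if xy: "x \<in> U" "y \<noteq> 0" for k x y
  proof -
    have "hdelta F k G x y = hdelta F k (\<lambda>x y. e x * F x y + (\<Sum>i\<in>UNIV. b x $ i * y $ i)) x y"
      by (rule F.hdelta_cong[OF xy G_eq]) (simp_all add: smooth)
    also have "\<dots> = (\<Sum>i\<in>UNIV. y $ i * hdelta F k (\<lambda>x y. b x $ i) x y) - (\<Sum>i\<in>UNIV. b x $ i * F.N i k x y)"
      by (simp add: F.hdelta_rules[OF xy] smooth F.hdelta_F[OF xy] hdelta_e e[OF xy] sum.distrib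
          sum_subtractf mult.commute)
    also have "(\<Sum>i\<in>UNIV. y $ i * hdelta F k (\<lambda>x y. b x $ i) x y) =
        (\<Sum>i\<in>UNIV. y $ i * (\<Sum>r\<in>UNIV. b x $ r * cartan F r i k x y))"
      using b[OF xy] by (simp add: hcov_def)
    also have "\<dots> = (\<Sum>r\<in>UNIV. b x $ r * (\<Sum>i\<in>UNIV. y $ i * cartan F r i k x y))"
      by (rule sum_mult_swap')
    finally show ?thesis
      by (simp add: F.euler_cartan[OF xy])
  qed
  show "hdelta F k (sq G) x y = 0" if "x \<in> U" "y \<noteq> 0" for k x y
    using F.hdelta_mult[OF that G.sm_F G.sm_F, of k] G0[OF that] by (simp add: power2_eq_square)
  have par: "hdelta F k (dy i G) x y = (\<Sum>r\<in>UNIV. dy r G x y * cartan F r i k x y)" for i k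
    using hdelta_dy_G[OF xy, of k i] e[OF xy] b[OF xy] by simp
  \<comment> \<open>The angular tensor of \<open>G\<close> is \<open>G e dy i (dy j F)\<close>, and
    \<open>F dy i (dy j F)\<close> is \<open>metric F\<close> minus the product of the first
    derivatives. Multiplying by \<open>F\<close> avoids quotients.\<close>
  have gG: "F x y * metric G i j x y = F x y * (dy i G x y * dy j G x y)
      + G x y * e x * (metric F i j x y - dy i F x y * dy j F x y)" if "x \<in> U" "y \<noteq> 0" for i j x y
    unfolding G.metric_dy_F[OF that] F.metric_dy_F[OF that] dy_dy_G[OF that]
    by (simp add: algebra_simps)
  fix i j k
  have "F x y * hdelta F k (metric G i j) x y = hdelta F k (\<lambda>x y. F x y * metric G i j x y) x y"
    by (simp add: F.hdelta_rules[OF xy] smooth F.hdelta_F[OF xy])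
  also have "\<dots> = hdelta F k (\<lambda>x y. F x y * (dy i G x y * dy j G x y)
      + G x y * e x * (metric F i j x y - dy i F x y * dy j F x y)) x y"
    by (rule F.hdelta_cong[OF xy gG]) (simp_all add: smooth)
  also have "\<dots> = F x y * (hdelta F k (dy i G) x y * dy j G x y + dy i G x y * hdelta F k (dy j G) x y)
      + G x y * e x * (hdelta F k (metric F i j) x y -
          (hdelta F k (dy i F) x y * dy j F x y + dy i F x y * hdelta F k (dy j F) x y))"
    by (simp add: F.hdelta_rules[OF xy] smooth F.hdelta_F[OF xy] G0[OF xy] hdelta_e e[OF xy])
  also have "\<dots> = (\<Sum>r\<in>UNIV. (F x y * metric G r j x y) * cartan F r i k x y)
      + (\<Sum>r\<in>UNIV. (F x y * metric G i r x y) * cartan F r j k x y)"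
    unfolding gG[OF xy] par F.hdelta_dy_F[OF xy] F.metric_parallel[OF xy]
    by (simp add: sum_distrib_left sum_distrib_right sum.distrib sum_subtractf algebra_simps)
  also have "\<dots> = F x y * ((\<Sum>r\<in>UNIV. metric G r j x y * cartan F r i k x y)
      + (\<Sum>r\<in>UNIV. metric G i r x y * cartan F r j k x y))"
    by (simp add: sum_distrib_left distrib_left mult.assoc)
  finally show "hdelta F k (metric G i j) x y = (\<Sum>r\<in>UNIV. metric G r j x y * cartan F r i k x y)
      + (\<Sum>r\<in>UNIV. metric G i r x y * cartan F r j k x y)"
    using F.pos[OF xy] by simp
qed

lemma conformal_iff:
  assumes "\<And>x. x \<in> U \<Longrightarrow> b x = 0"
  shows "(\<forall>x\<in>U. \<forall>y. y \<noteq> 0 \<longrightarrow> (\<forall>i j k. cartan G i j k x y = cartan F i j k x y)) \<longleftrightarrow>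
    (\<forall>x\<in>U. \<forall>y. y \<noteq> 0 \<longrightarrow> (\<forall>k. dx k (\<lambda>x y. e x) x y = 0))"
proof -
  have b: "hcov F b i k x y = 0" if "x \<in> U" "y \<noteq> 0" for i k x y
    using F.hdelta_cong[OF that _ sm_b, of i "\<lambda>x y. 0" k] F.hdelta_const[OF that, of k 0] assms that
    by (simp add: hcov_def)
  \<comment> \<open>Contracting \<open>dx k e * dy i F = 0\<close> with \<open>y^i\<close> gives
    \<open>dx k e * F = 0\<close> by Euler's theorem, and \<open>F\<close> is positive.\<close>
  have e: "dx k (\<lambda>x y. e x) x y = 0"
    if xy: "x \<in> U" "y \<noteq> 0" and C: "\<And>i j k. cartan G i j k x y = cartan F i j k x y" for x y k
  proof -
    have "dx k (\<lambda>x y. e x) x y * dy i F x y = 0" for i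
      using cartan_eq_imp[OF xy C, of k i] b[OF xy] by simp
    moreover have "(\<Sum>i\<in>UNIV. y $ i * dy i F x y) = F x y"
      using F.euler_homogeneous[OF xy F.sm_F, of 1] F.homogeneous[OF xy(1)] by simp
    ultimately show ?thesis
      using F.pos[OF xy] by (cases "dx k (\<lambda>x y. e x) x y = 0") auto
  qed
  show ?thesis
  proof (intro iffI ballI allI impI)
    fix x y :: "real ^ 'n" and k
    assume "\<forall>x\<in>U. \<forall>y. y \<noteq> 0 \<longrightarrow> (\<forall>i j k. cartan G i j k x y = cartan F i j k x y)" "x \<in> U" "y \<noteq> 0"
    then show "dx k (\<lambda>x y. e x) x y = 0"
      by (intro e) simp_all
  next
    fix x y :: "real ^ 'n" and i j k
    assume "\<forall>x\<in>U. \<forall>y. y \<noteq> 0 \<longrightarrow> (\<forall>k. dx k (\<lambda>x y. e x) x y = 0)" "x \<in> U" "y \<noteq> 0"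
    then show "cartan G i j k x y = cartan F i j k x y"
      by (intro cartan_eqI b) simp_all
  qed
qed

lemma beta_change_iff:
  assumes "\<And>x. x \<in> U \<Longrightarrow> e x = 1"
  shows "(\<forall>x\<in>U. \<forall>y. y \<noteq> 0 \<longrightarrow> (\<forall>i j k. cartan G i j k x y = cartan F i j k x y)) \<longleftrightarrow>
    (\<forall>x\<in>U. \<forall>y. y \<noteq> 0 \<longrightarrow> (\<forall>i k. hcov F b i k x y = 0))"
proof -
  have e: "dx k (\<lambda>x y. e x) x y = 0" if "x \<in> U" "y \<noteq> 0" for k x y
    using F.dx_cong[OF _ sm_e that, of "\<lambda>x y. 1" k] assms F.dx_const[of k 1] by simp
  have b: "hcov F b i k x y = 0"
    if xy: "x \<in> U" "y \<noteq> 0" and C: "\<And>i j k. cartan G i j k x y = cartan F i j k x y" for i k x y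
    using cartan_eq_imp[OF xy C] e[OF xy] by simp
  show ?thesis
  proof (intro iffI ballI allI impI)
    fix x y :: "real ^ 'n" and i k
    assume "\<forall>x\<in>U. \<forall>y. y \<noteq> 0 \<longrightarrow> (\<forall>i j k. cartan G i j k x y = cartan F i j k x y)" "x \<in> U" "y \<noteq> 0"
    then show "hcov F b i k x y = 0"
      by (intro b) simp_all
  next
    fix x y :: "real ^ 'n" and i j k
    assume "\<forall>x\<in>U. \<forall>y. y \<noteq> 0 \<longrightarrow> (\<forall>i k. hcov F b i k x y = 0)" "x \<in> U" "y \<noteq> 0"
    then show "cartan G i j k x y = cartan F i j k x y"
      by (intro cartan_eqI e) simp_all
  qed
qed

end

section \<open>From charts to the manifold\<close>

lemma finsler_metric_chart:
  assumes "finsler_metric \<A> L" "c \<in> \<A>" "open (coord_dom c)"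
  shows "finsler_chart (coord_dom c) (L c)"
  using assms unfolding finsler_metric_def
  by unfold_locales (auto simp: slit_smooth_def)

text \<open>Composing with \<open>ln\<close> recovers the derivative of \<open>h\<close> along the
  axis: it is that of \<open>exp h\<close> divided by the positive value
  \<open>exp (h x)\<close>.\<close>

lemma exp_partial_eq_0_iff:
  assumes "slit_smooth U (\<lambda>x y. exp (h x))" "open U" "x \<in> U" "y \<noteq> 0"
  shows "dx k (\<lambda>x y. exp (h x)) x y = 0 \<longleftrightarrow> deriv (\<lambda>t. h (x + t *\<^sub>R axis k 1)) 0 = 0"
proof -
  interpret slit_bundle U by unfold_locales fact
  have "((\<lambda>t. exp (h (x + t *\<^sub>R axis k 1))) has_real_derivative dx k (\<lambda>x y. exp (h x)) x y) (at 0)"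
    by (rule sm_DERIV_dx[OF assms(1,3,4)])
  then have "((\<lambda>t. ln (exp (h (x + t *\<^sub>R axis k 1)))) has_real_derivative
      1 / exp (h x) * dx k (\<lambda>x y. exp (h x)) x y) (at 0)"
    by (intro DERIV_chain'[where g = ln]) (auto intro!: derivative_eq_intros)
  then have "deriv (\<lambda>t. h (x + t *\<^sub>R axis k 1)) 0 = dx k (\<lambda>x y. exp (h x)) x y / exp (h x)"
    by (simp add: DERIV_imp_deriv)
  then show ?thesis by simp
qed

context
  fixes M :: "'m topology" and \<A> :: "('m, 'n::finite) chart set" and L \<sigma> b c
  assumes M: "smooth_manifold M \<A>" and L: "finsler_metric \<A> L"
    and L': "finsler_metric \<A> (beta_conformal_change \<sigma> b L)" and c: "c \<in> \<A>"
begin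

lemma chart_pair: "finsler_pair (coord_dom c) (L c) (beta_conformal_change \<sigma> b L c)"
proof -
  have "open (coord_dom c)"
    using M c unfolding smooth_manifold_def by blast
  then show ?thesis
    unfolding finsler_pair_def using finsler_metric_chart L L' c by blast
qed

lemma conformal_chart:
  assumes b: "\<And>x. x \<in> coord_dom c \<Longrightarrow> b c x = 0"
  shows "(\<forall>x\<in>coord_dom c. \<forall>y. y \<noteq> 0 \<longrightarrow>
      (\<forall>i j k. cartan_diff (beta_conformal_change \<sigma> b L c) (L c) i j k x y = 0)) \<longleftrightarrow>
    (\<forall>x\<in>coord_dom c. \<forall>i. deriv (\<lambda>t. local_rep \<sigma> c (x + t *\<^sub>R axis i 1)) 0 = 0)"
proof -
  interpret finsler_pair "coord_dom c" "L c" "beta_conformal_change \<sigma> b L c"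
    by (rule chart_pair)
  let ?e = "\<lambda>x. exp (local_rep \<sigma> c x)"
  have eq: "beta_conformal_change \<sigma> b L c x y = ?e x * L c x y" if "x \<in> coord_dom c" for x y
    using b[OF that] by (simp add: beta_conformal_change_def)
  \<comment> \<open>The conformal factor is the quotient of the two Finsler functions, hence smooth
    on the slit bundle.\<close>
  have e: "F.sm (\<lambda>x y. ?e x)"
  proof (rule F.sm_cong)
    show "F.sm (\<lambda>x y. beta_conformal_change \<sigma> b L c x y / L c x y)"
      using F.sm_divide[OF G.sm_F F.sm_F] F.pos by fastforce
    show "beta_conformal_change \<sigma> b L c x y / L c x y = ?e x" if "x \<in> coord_dom c" "y \<noteq> 0" for x y
      using eq[OF that(1)] F.pos[OF that] by simp
  qed
  interpret beta_conformal_pair "coord_dom c" "L c" "beta_conformal_change \<sigma> b L c" ?e "\<lambda>x. 0"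
    by unfold_locales (simp_all add: e eq F.sm_const)
  have "dx k (\<lambda>x y. ?e x) x y = 0 \<longleftrightarrow> deriv (\<lambda>t. local_rep \<sigma> c (x + t *\<^sub>R axis k 1)) 0 = 0"
    if "x \<in> coord_dom c" "y \<noteq> 0" for x y k
    by (rule exp_partial_eq_0_iff[OF e F.open_base that])
  \<comment> \<open>The condition on \<sigma> does not mention \<open>y\<close>, so some nonzero
    vector is needed to extract it from a statement about all y \<noteq> 0.\<close>
  moreover have "\<exists>y :: real ^ 'n. y \<noteq> 0"
    by (metis axis_eq_0_iff zero_neq_one)
  ultimately show ?thesis
    using conformal_iff by (simp add: cartan_diff_def)
qed

lemma beta_chart:
  assumes \<sigma>: "\<And>x. x \<in> coord_dom c \<Longrightarrow> local_rep \<sigma> c x = 0"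
  shows "(\<forall>x\<in>coord_dom c. \<forall>y. y \<noteq> 0 \<longrightarrow>
      (\<forall>i j k. cartan_diff (beta_conformal_change \<sigma> b L c) (L c) i j k x y = 0)) \<longleftrightarrow>
    (\<forall>x\<in>coord_dom c. \<forall>y. y \<noteq> 0 \<longrightarrow> (\<forall>i j. hcov (L c) (b c) i j x y = 0))"
proof -
  interpret finsler_pair "coord_dom c" "L c" "beta_conformal_change \<sigma> b L c"
    by (rule chart_pair)
  have eq: "beta_conformal_change \<sigma> b L c x y = L c x y + (\<Sum>i\<in>UNIV. b c x $ i * y $ i)"
    if "x \<in> coord_dom c" for x y
    using \<sigma>[OF that] by (simp add: beta_conformal_change_def)
  \<comment> \<open>The components of \<open>b c\<close> are the \<open>y\<close>-derivatives of the
    difference of the two Finsler functions, which gives their smoothness.\<close>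
  have b: "F.sm (\<lambda>x y. b c x $ i)" for i
  proof (rule F.sm_cong)
    show "F.sm (dy i (\<lambda>x y. beta_conformal_change \<sigma> b L c x y - L c x y))"
      by (intro F.sm_dy F.sm_diff F.sm_F G.sm_F)
    fix x y :: "real ^ 'n" assume xy: "x \<in> coord_dom c" "y \<noteq> 0"
    have "((\<lambda>t. \<Sum>k\<in>UNIV. b c x $ k * (y + t *\<^sub>R axis i 1) $ k) has_real_derivative
        (\<Sum>k\<in>UNIV. b c x $ k * axis i 1 $ k)) (at 0)"
      by (auto intro!: derivative_eq_intros sum.cong)
    moreover have "(\<Sum>k\<in>UNIV. b c x $ k * axis i 1 $ k) = b c x $ i"
      by (simp add: axis_def if_distrib[of "\<lambda>c. _ * c"] cong: if_cong)
    ultimately show "dy i (\<lambda>x y. beta_conformal_change \<sigma> b L c x y - L c x y) x y = b c x $ i"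
      using eq[OF xy(1)] by (simp add: dy_def DERIV_imp_deriv)
  qed
  interpret beta_conformal_pair "coord_dom c" "L c" "beta_conformal_change \<sigma> b L c" "\<lambda>x. 1" "b c"
    by unfold_locales (simp_all add: b eq F.sm_const)
  show ?thesis
    using beta_change_iff by (simp add: cartan_diff_def)
qed

end

theorem theoremC:
  fixes M :: "'m topology"
    and \<A> :: "('m, 'n::finite) chart set"
    and L :: "('m, 'n) chart \<Rightarrow> real ^ 'n \<Rightarrow> real ^ 'n \<Rightarrow> real"
    and \<sigma> :: "'m \<Rightarrow> real"
    and b :: "('m, 'n) chart \<Rightarrow> real ^ 'n \<Rightarrow> real ^ 'n"
  assumes "smooth_manifold M \<A>"
    and "finsler_metric \<A> L"
    and "smooth_function \<A> \<sigma>"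
    and "one_form \<A> b"
    and "finsler_metric \<A> (beta_conformal_change \<sigma> b L)"
  shows "((\<forall>c\<in>\<A>. \<forall>x\<in>coord_dom c. b c x = 0) \<longrightarrow>
            (cartan_diff_vanishes \<A> (beta_conformal_change \<sigma> b L) L \<longleftrightarrow> homothetic \<A> \<sigma>)) \<and>
         ((\<forall>p\<in>topspace M. \<sigma> p = 0) \<longrightarrow>
            (cartan_diff_vanishes \<A> (beta_conformal_change \<sigma> b L) L \<longleftrightarrow> cartan_parallel \<A> L b))"
proof (intro conjI impI)
  assume "\<forall>c\<in>\<A>. \<forall>x\<in>coord_dom c. b c x = 0"
  then have b: "b c x = 0" if "c \<in> \<A>" "x \<in> coord_dom c" for c x
    using that by blast
  show "cartan_diff_vanishes \<A> (beta_conformal_change \<sigma> b L) L \<longleftrightarrow> homothetic \<A> \<sigma>"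
    unfolding cartan_diff_vanishes_def homothetic_def
    by (rule ball_cong[OF refl]) (rule conformal_chart[OF assms(1,2,5)], assumption, rule b, assumption)
next
  assume \<sigma>: "\<forall>p\<in>topspace M. \<sigma> p = 0"
  have rep: "local_rep \<sigma> c x = 0" if "c \<in> \<A>" "x \<in> coord_dom c" for c x
  proof -
    have "chart_inv c x \<in> fst c"
      using that(2) by (simp add: chart_inv_def coord_dom_def inv_into_into)
    moreover have "fst c \<subseteq> topspace M"
      using assms(1) that(1) by (auto simp: smooth_manifold_def)
    ultimately show ?thesis
      using \<sigma> by (auto simp: local_rep_def)
  qed
  show "cartan_diff_vanishes \<A> (beta_conformal_change \<sigma> b L) L \<longleftrightarrow> cartan_parallel \<A> L b"
    unfolding cartan_diff_vanishes_def cartan_parallel_def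
    by (rule ball_cong[OF refl]) (rule beta_chart[OF assms(1,2,5)], assumption, rule rep, assumption)
qed

end
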